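(* Let $T\subset\mathbb{R}^3$ be a nondegenerate tetrahedron with Alfeld split $T^z$ and let $r\ge5$. Any $\omega\in M_{d,r-3}^3(T^z)$ is uniquely determined by the degrees of freedom (DOFs) (a) $\omega(a)$ for all $a\in\Delta_0(T)$ ($4$ DOFs); (b) $\int_e\omega\kappa\,ds$ for all $\kappa\in\mathcal{P}_{r-5}(e)$, $e\in\Delta_1(T)$ ($6(r-4)$ DOFs); (c) $\int_F\omega\kappa\,dA$ for all $\kappa\in\mathcal{P}_{r-6}(F)$, $F\in\Delta_2(T)$ ($2(r-4)(r-5)$ DOFs); (d) $\int_T\omega\,dx$ ($1$ DOF); (e) $\int_T\omega\kappa\,dx$ for all $\kappa\in\mathring{M}_{d,r-3}^3(T^z)$ ($\frac13(2r-7)(r^2-7r+15)-1$ DOFs).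
   Context: Let $T=[x_0,x_1,x_2,x_3]\subset\mathbb{R}^3$ be a nondegenerate tetrahedron with barycenter $z$. The Alfeld split is $T^z=\{T_0,\dots,T_3\}$, where $T_i$ is obtained from $T$ by replacing the vertex $x_i$ by $z$. $\Delta_s(T)$ is the set of $s$-dimensional subsimplices of $T$ (vertices, edges, faces for $s=0,1,2$). $\mathcal{P}_r(S)$ denotes polynomials of total degree at most $r$ on a simplex $S$, $\{0\}$ if $r<0$. $M_{d,r}^3(T^z)=\{\omega\in C^0(T):\omega|_{T_i}\in\mathcal{P}_r(T_i),\ 0\le i\le3\}$; $\mathring{M}_{d,r}^3(T^z)=\{\omega\in M_{d,r}^3(T^z):\omega=0\text{ on }\partial T,\ \int_T\omega\,dx=0\}$. "($N$ DOFs)" is the number of scalar conditions when test functions run through a basis. "Uniquely determined" means that two elements of the space with the same values of all the DOFs coincide. *)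

theory Defs
  imports "HOL-Analysis.Analysis" "HOL-Library.Function_Algebras"
begin

text \<open>
  Real-valued functions form a real vector space under the pointwise operations, so that the
  library's \<open>dim\<close> applies to spaces of functions.
\<close>

instantiation "fun" :: (type, real_vector) real_vector
begin

definition scaleR_fun :: "real \<Rightarrow> ('a \<Rightarrow> 'b) \<Rightarrow> 'a \<Rightarrow> 'b"
  where "scaleR_fun c f = (\<lambda>x. c *\<^sub>R f x)"

instance
  by standard (simp_all add: scaleR_fun_def plus_fun_def fun_eq_iff algebra_simps)

end

text \<open>
  A simplex is given by the list of its vertices. A function on a set \<open>S\<close> is represented by its
  extension by zero to the whole space, so that equality of two such functions (and hence the
  dimension of a space of them) only depends on their values on \<open>S\<close>.
\<close>

definition hull_of :: "(real^3) list \<Rightarrow> (real^3) set"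
  where "hull_of vs = convex hull (set vs)"

definition subsimplices :: "nat \<Rightarrow> (real^3) list \<Rightarrow> (real^3) list set"
  where "subsimplices s T = {vs \<in> set (subseqs T). length vs = s + 1}"

definition barycenter :: "(real^3) list \<Rightarrow> real^3"
  where "barycenter T = (1 / real (length T)) *\<^sub>R sum_list T"

definition alfeld :: "(real^3) list \<Rightarrow> nat \<Rightarrow> (real^3) list"
  where "alfeld T i = T[i := barycenter T]"

definition on_set :: "(real^3) set \<Rightarrow> (real^3 \<Rightarrow> real) \<Rightarrow> real^3 \<Rightarrow> real"
  where "on_set S f = (\<lambda>x. if x \<in> S then f x else 0)"

text \<open>
  Degrees are integers: for \<open>r < 0\<close> the index set is empty and only the zero function remains.
\<close>

definition poly_fun :: "int \<Rightarrow> (real^3 \<Rightarrow> real) set"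
  where "poly_fun r = {p. \<exists>c :: nat \<times> nat \<times> nat \<Rightarrow> real. \<forall>x. p x =
    (\<Sum>(i, j, k) | int (i + j + k) \<le> r. c (i, j, k) * (x$1 ^ i * x$2 ^ j * x$3 ^ k))}"

definition poly_on :: "int \<Rightarrow> (real^3) set \<Rightarrow> (real^3 \<Rightarrow> real) set"
  where "poly_on r S = on_set S ` poly_fun r"

definition M3 :: "int \<Rightarrow> (real^3) list \<Rightarrow> (real^3 \<Rightarrow> real) set"
  where "M3 r T = {\<omega>. (\<forall>x. x \<notin> hull_of T \<longrightarrow> \<omega> x = 0) \<and> continuous_on (hull_of T) \<omega> \<and>
    (\<forall>i < length T. on_set (hull_of (alfeld T i)) \<omega> \<in> poly_on r (hull_of (alfeld T i)))}"

definition M3_zero :: "int \<Rightarrow> (real^3) list \<Rightarrow> (real^3 \<Rightarrow> real) set"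
  where "M3_zero r T = {\<omega> \<in> M3 r T. (\<forall>x \<in> frontier (hull_of T). \<omega> x = 0) \<and>
    (LINT x : hull_of T | lborel. \<omega> x) = 0}"

text \<open>
  Arc length and surface integrals over the segment \<open>[a, b]\<close> and the triangle \<open>[a, b, c]\<close>, by
  affine parametrization over the unit interval and the unit triangle.
\<close>

definition edge_integral :: "real^3 \<Rightarrow> real^3 \<Rightarrow> (real^3 \<Rightarrow> real) \<Rightarrow> real"
  where "edge_integral a b f =
    (LINT t : {0..1} | lborel. f (a + t *\<^sub>R (b - a)) * norm (b - a))"

definition face_integral :: "real^3 \<Rightarrow> real^3 \<Rightarrow> real^3 \<Rightarrow> (real^3 \<Rightarrow> real) \<Rightarrow> real"
  where "face_integral a b c f =
    (LINT p : {(s, t). 0 \<le> s \<and> 0 \<le> t \<and> s + t \<le> 1} | (lborel :: (real \<times> real) measure).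
      f (a + fst p *\<^sub>R (b - a) + snd p *\<^sub>R (c - a)) * norm (cross3 (b - a) (c - a)))"

end

theory Submission
  imports Defs
begin

text \<open>
  Everything is expressed by monomials in barycentric coordinates. On a simplex with vertices
  \<open>v\<^sub>0, \<dots>, v\<^sub>n\<close>, multiplying each monomial by a suitable power of \<open>y\<^sub>0 + \<dots> + y\<^sub>n = 1\<close> turns a polynomial
  of degree at most \<open>k\<close> into a homogeneous form of degree \<open>k\<close> in the barycentric coordinates \<open>y\<close>. The
  coefficients of such a form are unique, and on the face spanned by a set \<open>S'\<close> of vertices exactly
  the monomials with exponents supported in \<open>S'\<close> survive (\<open>form_coeffs_eq_0_on_face\<close>). Hence a
  polynomial that vanishes on all proper faces has only monomials divisible by the bubble
  \<open>y\<^sub>0 \<cdots> y\<^sub>n\<close>, and the quotient has degree \<open>k - (n + 1)\<close> (\<open>bubble_factor\<close>).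

  Write \<open>k = r - 3\<close>. For the uniqueness consider the difference of two elements with the same degrees of
  freedom. On an edge it is a polynomial that vanishes at both ends, so it is the edge bubble times
  some \<open>\<kappa>\<close> of degree \<open>k - 2 = r - 5\<close>. Testing with this \<open>\<kappa>\<close> gives the integral of the bubble times
  \<open>\<kappa>\<^sup>2\<close>, which can only vanish if \<open>\<kappa>\<close> vanishes on the edge. Then the same argument with degree
  \<open>k - 3 = r - 6\<close> applies on the faces. Now the difference vanishes on the boundary and has mean zero,
  so it is one of the interior test functions, and testing it with itself shows that it is zero.

  For the dimension of the space of interior test functions let \<open>\<lambda>\<^sub>i\<close> be the barycentric coordinates of
  the tetrahedron and \<open>m\<close> their minimum. The hat functions of the Alfeld split are \<open>\<lambda>\<^sub>i - m\<close> for
  \<open>i < 4\<close> and \<open>4 m\<close> for the barycenter. They sum to 1, restrict on each piece to its barycentric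
  coordinates, and at every point one of the first four vanishes. The monomials of degree \<open>k\<close> in
  them, leaving out those that involve all of the first four, form a basis of the continuous splines:
  two polynomials on adjacent pieces agree on the common face exactly when their common coefficients
  agree (\<open>M3_expansion\<close>). The boundary is where \<open>m = 0\<close>, so the splines that vanish there are spanned
  by the basis elements that contain the fifth hat function. There are
  \<open>(k + 3 choose 4) - (k - 1 choose 4)\<close> of them, and the condition of mean zero removes one dimension.
\<close>

section \<open>Homogeneous forms on simplices\<close>

definition multi_indices :: "nat set \<Rightarrow> nat \<Rightarrow> (nat \<Rightarrow> nat) set"
  where "multi_indices S k = {\<beta>. (\<forall>i. i \<notin> S \<longrightarrow> \<beta> i = 0) \<and> sum \<beta> S = k}"

definition monomial :: "nat set \<Rightarrow> (nat \<Rightarrow> nat) \<Rightarrow> (nat \<Rightarrow> real) \<Rightarrow> real"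
  where "monomial S \<beta> y = (\<Prod>i\<in>S. y i ^ \<beta> i)"

text \<open>
  The homogeneous polynomials of degree \<open>k\<close> in the variables indexed by \<open>S\<close>.
\<close>

definition form :: "nat set \<Rightarrow> nat \<Rightarrow> ((nat \<Rightarrow> real) \<Rightarrow> real) \<Rightarrow> bool"
  where "form S k f \<longleftrightarrow> (\<exists>c. \<forall>y. f y = (\<Sum>\<beta>\<in>multi_indices S k. c \<beta> * monomial S \<beta> y))"

lemma finite_multi_indices:
  assumes "finite S" shows "finite (multi_indices S k)"
proof (rule finite_subset)
  show "multi_indices S k \<subseteq> {f. \<forall>i. (i \<in> S \<longrightarrow> f i \<in> {..k}) \<and> (i \<notin> S \<longrightarrow> f i = 0)}"
    using assms by (auto simp: multi_indices_def intro: member_le_sum)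
  show "finite {f. \<forall>i. (i \<in> S \<longrightarrow> f i \<in> {..k}) \<and> (i \<notin> S \<longrightarrow> f i = (0::nat))}"
    using assms by (rule finite_set_of_finite_funs) auto
qed

lemma multi_indices_mono:
  assumes "finite S" "S' \<subseteq> S"
  shows "multi_indices S' k \<subseteq> multi_indices S k"
proof
  fix \<beta> assume b: "\<beta> \<in> multi_indices S' k"
  then have "sum \<beta> S = sum \<beta> S'"
    using assms by (intro sum.mono_neutral_right) (auto simp: multi_indices_def)
  with b assms show "\<beta> \<in> multi_indices S k" by (auto simp: multi_indices_def)
qed

lemma multi_indices_face_iff:
  assumes "finite S" "S' \<subseteq> S" "\<beta> \<in> multi_indices S k"
  shows "\<beta> \<in> multi_indices S' k \<longleftrightarrow> (\<forall>i\<in>S - S'. \<beta> i = 0)"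
proof
  assume z: "\<forall>i\<in>S - S'. \<beta> i = 0"
  then have "sum \<beta> S = sum \<beta> S'"
    using assms by (intro sum.mono_neutral_right) auto
  with z assms show "\<beta> \<in> multi_indices S' k" by (auto simp: multi_indices_def)
qed (auto simp: multi_indices_def)

lemma monomial_face:
  assumes "finite S" "S' \<subseteq> S" "\<beta> \<in> multi_indices S' k"
  shows "monomial S \<beta> y = monomial S' \<beta> y"
  unfolding monomial_def using assms
  by (intro prod.mono_neutral_right) (auto simp: multi_indices_def)

lemma monomial_eq_0:
  assumes "finite S" "i \<in> S" "y i = 0" "\<beta> i \<noteq> 0"
  shows "monomial S \<beta> y = 0"
  using assms by (auto simp: monomial_def prod_zero_iff)

lemma monomial_scale: "\<beta> \<in> multi_indices S k \<Longrightarrow> monomial S \<beta> (\<lambda>i. t * y i) = t ^ k * monomial S \<beta> y"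
  by (auto simp: monomial_def multi_indices_def power_mult_distrib prod.distrib power_sum)

text \<open>
  Fix all variables but one: the sum is then a polynomial in that variable with infinitely many
  roots, so its coefficients vanish, and these are sums over fewer variables. The exponents need only
  be determined by their values on \<open>S\<close>, which is what survives when \<open>S\<close> shrinks.
\<close>

lemma monomial_independent:
  assumes "finite S" "finite D"
    and "\<And>\<beta> \<gamma>. \<beta> \<in> D \<Longrightarrow> \<gamma> \<in> D \<Longrightarrow> (\<And>i. i \<in> S \<Longrightarrow> \<beta> i = \<gamma> i) \<Longrightarrow> \<beta> = \<gamma>"
    and "\<And>y. (\<And>i. i \<in> S \<Longrightarrow> 0 < y i) \<Longrightarrow> (\<Sum>\<beta>\<in>D. c \<beta> * monomial S \<beta> y) = 0"
    and "\<beta> \<in> D"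
  shows "c \<beta> = 0"
  using assms
proof (induction S arbitrary: D rule: finite_induct)
  case empty
  then have "D = {\<beta>}" by auto
  with empty.prems(3)[of "\<lambda>_. 1"] show ?case by (simp add: monomial_def)
next
  case (insert a S)
  (* Group the exponents by their value at the split-off variable a. *)
  define E where "E n = {\<gamma>\<in>D. \<gamma> a = n}" for n
  define N where "N = Max ((\<lambda>\<gamma>. \<gamma> a) ` D)"
  have N: "\<gamma> a \<le> N" if "\<gamma> \<in> D" for \<gamma>
    using insert.prems(1) that by (auto simp: N_def)
  have "(\<Sum>\<gamma>\<in>E n. c \<gamma> * monomial S \<gamma> y) = 0" if y: "\<And>i. i \<in> S \<Longrightarrow> 0 < y i" for y n
  proof -
    let ?q = "\<lambda>n. \<Sum>\<gamma>\<in>E n. c \<gamma> * monomial S \<gamma> y"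
    have "(\<Sum>n\<le>N. ?q n * t ^ n) = 0" if t: "0 < t" for t
    proof -
      let ?y = "y(a := t)"
      have m: "monomial (insert a S) \<gamma> ?y = t ^ \<gamma> a * monomial S \<gamma> y" for \<gamma>
      proof -
        have "(\<Prod>i\<in>S. ?y i ^ \<gamma> i) = (\<Prod>i\<in>S. y i ^ \<gamma> i)"
          using insert.hyps by (intro prod.cong) auto
        then show ?thesis using insert.hyps by (simp add: monomial_def)
      qed
      have "(\<Sum>n\<le>N. ?q n * t ^ n) = (\<Sum>n\<le>N. \<Sum>\<gamma>\<in>E n. c \<gamma> * monomial (insert a S) \<gamma> ?y)"
        unfolding sum_distrib_right
        by (intro sum.cong refl) (auto simp: E_def m algebra_simps)
      also have "\<dots> = (\<Sum>\<gamma>\<in>D. c \<gamma> * monomial (insert a S) \<gamma> ?y)"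
        unfolding E_def using insert.prems(1) N by (intro sum.group) auto
      also have "\<dots> = 0" using y t by (intro insert.prems(3)) auto
      finally show ?thesis .
    qed
    then have "{0<..} \<subseteq> {t. (\<Sum>n\<le>N. ?q n * t ^ n) = 0}" by auto
    then have "infinite {t. (\<Sum>n\<le>N. ?q n * t ^ n) = 0}"
      using infinite_Ioi infinite_super by blast
    then have "\<forall>n\<le>N. ?q n = 0" using polyfun_finite_roots[of ?q N] by auto
    moreover have "?q n = 0" if "n > N"
    proof -
      have "E n = {}" using N that by (fastforce simp: E_def)
      then show ?thesis by simp
    qed
    ultimately show ?thesis by (meson not_le)
  qed
  note inner = this
  show ?case
  proof (rule insert.IH[of "E (\<beta> a)"])
    show "\<gamma> = \<delta>" if "\<gamma> \<in> E (\<beta> a)" "\<delta> \<in> E (\<beta> a)" "\<And>i. i \<in> S \<Longrightarrow> \<gamma> i = \<delta> i" for \<gamma> \<delta>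
      using that by (intro insert.prems(2)) (auto simp: E_def)
  qed (use insert.prems inner in \<open>auto simp: E_def\<close>)
qed

lemma form_monomial: "finite S \<Longrightarrow> \<beta> \<in> multi_indices S k \<Longrightarrow> form S k (monomial S \<beta>)"
  unfolding form_def
  by (rule exI[of _ "\<lambda>\<gamma>. if \<gamma> = \<beta> then 1 else 0"])
     (simp add: finite_multi_indices if_distrib[of "\<lambda>x. x * _"] cong: if_cong)

lemma form_0: "form S k (\<lambda>y. 0)"
  unfolding form_def by (rule exI[of _ "\<lambda>_. 0"]) simp

lemma form_add: "form S k f \<Longrightarrow> form S k g \<Longrightarrow> form S k (\<lambda>y. f y + g y)"
  unfolding form_def
  by (elim exE, rename_tac c d, rule_tac x = "\<lambda>\<beta>. c \<beta> + d \<beta>" in exI)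
     (simp add: sum.distrib algebra_simps)

lemma form_scale: "form S k f \<Longrightarrow> form S k (\<lambda>y. a * f y)"
  unfolding form_def
  by (elim exE, rename_tac c, rule_tac x = "\<lambda>\<beta>. a * c \<beta>" in exI)
     (simp add: sum_distrib_left algebra_simps)

lemma form_sum: "(\<And>i. i \<in> I \<Longrightarrow> form S k (f i)) \<Longrightarrow> form S k (\<lambda>y. \<Sum>i\<in>I. f i y)"
  by (induction I rule: infinite_finite_induct) (auto intro: form_0 form_add)

lemma form_mult:
  assumes "finite S" "form S k f" "form S l g"
  shows "form S (k + l) (\<lambda>y. f y * g y)"
proof -
  obtain c where c: "\<And>y. f y = (\<Sum>\<beta>\<in>multi_indices S k. c \<beta> * monomial S \<beta> y)"
    using assms by (auto simp: form_def)
  obtain d where d: "\<And>y. g y = (\<Sum>\<gamma>\<in>multi_indices S l. d \<gamma> * monomial S \<gamma> y)"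
    using assms by (auto simp: form_def)
  have "f y * g y = (\<Sum>\<beta>\<in>multi_indices S k. \<Sum>\<gamma>\<in>multi_indices S l.
      c \<beta> * d \<gamma> * monomial S (\<lambda>i. \<beta> i + \<gamma> i) y)" for y
    unfolding c d sum_product
    by (intro sum.cong refl) (simp add: monomial_def power_add prod.distrib)
  moreover have "form S (k + l) (\<lambda>y. \<Sum>\<beta>\<in>multi_indices S k. \<Sum>\<gamma>\<in>multi_indices S l.
      c \<beta> * d \<gamma> * monomial S (\<lambda>i. \<beta> i + \<gamma> i) y)"
    using assms
    by (intro form_sum form_scale form_monomial) (auto simp: multi_indices_def sum.distrib)
  ultimately show ?thesis by simp
qed

lemma form_1: "finite S \<Longrightarrow> form S 0 (\<lambda>y. 1)"
proof -
  assume "finite S"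
  then have "multi_indices S 0 = {\<lambda>_. 0}" by (auto simp: multi_indices_def fun_eq_iff)
  then show ?thesis unfolding form_def by (intro exI[of _ "\<lambda>_. 1"]) (simp add: monomial_def)
qed

lemma form_power: "finite S \<Longrightarrow> form S k f \<Longrightarrow> form S (n * k) (\<lambda>y. f y ^ n)"
  by (induction n) (auto intro: form_1 form_mult)

lemma form_linear:
  assumes "finite S" shows "form S 1 (\<lambda>y. \<Sum>i\<in>S. y i * a i)"
proof -
  have "form S 1 (\<lambda>y. a i * y i)" if "i \<in> S" for i
  proof -
    have "(\<Prod>x\<in>S. y x ^ (if x = i then 1 else 0)) = y i" for y :: "nat \<Rightarrow> real"
      using assms that by (simp add: if_distrib[of "(^) _"] cong: if_cong)
    then have "monomial S (\<lambda>j. if j = i then 1 else 0) = (\<lambda>y. y i)"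
      by (simp add: fun_eq_iff monomial_def)
    moreover have "form S 1 (\<lambda>y. a i * monomial S (\<lambda>j. if j = i then 1 else 0) y)"
      using assms that by (intro form_scale form_monomial) (auto simp: multi_indices_def)
    ultimately show ?thesis by simp
  qed
  then show ?thesis by (intro form_sum) (simp add: mult.commute)
qed

definition coordinate_simplex :: "nat set \<Rightarrow> (nat \<Rightarrow> real) set"
  where "coordinate_simplex S = {y. (\<forall>j. 0 \<le> y j) \<and> (\<forall>j. j \<notin> S \<longrightarrow> y j = 0) \<and> sum y S = 1}"

lemma convex_hull_indexed:
  fixes w :: "nat \<Rightarrow> 'a::real_vector"
  assumes "finite S"
  shows "convex hull (w ` S) = (\<lambda>y. \<Sum>j\<in>S. y j *\<^sub>R w j) ` coordinate_simplex S"
proof (rule hull_unique)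
  show "w ` S \<subseteq> (\<lambda>y. \<Sum>j\<in>S. y j *\<^sub>R w j) ` coordinate_simplex S"
  proof (intro image_subsetI image_eqI)
    fix i assume "i \<in> S"
    then show "w i = (\<Sum>j\<in>S. (if j = i then 1 else 0) *\<^sub>R w j)"
      "(\<lambda>j. if j = i then 1 else 0) \<in> coordinate_simplex S"
      using assms by (auto simp: coordinate_simplex_def if_distrib[of "\<lambda>x. x *\<^sub>R _"] cong: if_cong)
  qed
  show "convex ((\<lambda>y. \<Sum>j\<in>S. y j *\<^sub>R w j) ` coordinate_simplex S)"
  proof (rule convexI, clarify)
    fix y z :: "nat \<Rightarrow> real" and a b :: real
    assume "y \<in> coordinate_simplex S" "z \<in> coordinate_simplex S" "0 \<le> a" "0 \<le> b" "a + b = 1"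
    then have "(\<lambda>j. a * y j + b * z j) \<in> coordinate_simplex S"
      by (auto simp: coordinate_simplex_def sum.distrib sum_distrib_left[symmetric])
    then show "a *\<^sub>R (\<Sum>j\<in>S. y j *\<^sub>R w j) + b *\<^sub>R (\<Sum>j\<in>S. z j *\<^sub>R w j)
        \<in> (\<lambda>y. \<Sum>j\<in>S. y j *\<^sub>R w j) ` coordinate_simplex S"
      by (intro image_eqI[of _ _ "\<lambda>j. a * y j + b * z j"])
         (simp_all add: scaleR_add_left sum.distrib scaleR_sum_right)
  qed
  show "(\<lambda>y. \<Sum>j\<in>S. y j *\<^sub>R w j) ` coordinate_simplex S \<subseteq> C" if "w ` S \<subseteq> C" "convex C" for C
    using that assms by (auto simp: coordinate_simplex_def intro!: convex_sum)
qed

lemma coordinate_simplex_mono: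
  assumes "finite S" "S' \<subseteq> S"
  shows "coordinate_simplex S' \<subseteq> coordinate_simplex S"
proof
  fix y assume y: "y \<in> coordinate_simplex S'"
  then have "sum y S = sum y S'"
    using assms by (intro sum.mono_neutral_right) (auto simp: coordinate_simplex_def)
  with y assms show "y \<in> coordinate_simplex S" by (auto simp: coordinate_simplex_def)
qed

lemma coordinate_simplex_subset_iff:
  assumes "finite S" "S' \<subseteq> S" "y \<in> coordinate_simplex S"
  shows "y \<in> coordinate_simplex S' \<longleftrightarrow> (\<forall>i\<in>S - S'. y i = 0)"
proof
  assume z: "\<forall>i\<in>S - S'. y i = 0"
  then have "sum y S = sum y S'"
    using assms by (intro sum.mono_neutral_right) auto
  with z assms show "y \<in> coordinate_simplex S'" by (auto simp: coordinate_simplex_def)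
qed (auto simp: coordinate_simplex_def)

text \<open>
  On the face only the monomials supported in \<open>S'\<close> are nonzero, and by homogeneity the sum vanishes
  not only on the simplex but on the whole open cone over it, where monomials are independent.
  Uniqueness of coefficients, matching across common faces and divisibility by bubbles are all
  instances of this.
\<close>

lemma form_coeffs_eq_0_on_face:
  assumes "finite S" "S' \<subseteq> S" "S' \<noteq> {}" "D \<subseteq> multi_indices S k"
    and zero: "\<And>y. y \<in> coordinate_simplex S' \<Longrightarrow>
      (\<Sum>\<beta>\<in>D. c \<beta> * monomial S \<beta> y) = 0"
    and "\<beta> \<in> D" "\<beta> \<in> multi_indices S' k"
  shows "c \<beta> = 0"
proof (rule monomial_independent[where S = S' and D = "D \<inter> multi_indices S' k" and c = c and \<beta> = \<beta>])
  have finD: "finite D" using assms finite_multi_indices finite_subset by metis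
  show "finite S'" using assms finite_subset by blast
  show "finite (D \<inter> multi_indices S' k)" using finD by auto
  show "\<beta> \<in> D \<inter> multi_indices S' k" using assms by auto
  show "\<gamma> = \<delta>" if "\<gamma> \<in> D \<inter> multi_indices S' k" "\<delta> \<in> D \<inter> multi_indices S' k"
    "\<And>i. i \<in> S' \<Longrightarrow> \<gamma> i = \<delta> i" for \<gamma> \<delta>
    using that by (fastforce simp: multi_indices_def fun_eq_iff)
  show "(\<Sum>\<beta>\<in>D \<inter> multi_indices S' k. c \<beta> * monomial S' \<beta> y) = 0"
    if y: "\<And>i. i \<in> S' \<Longrightarrow> 0 < y i" for y
  proof -
    (* Rescale y to a point u of the simplex; by homogeneity this changes all terms by the same factor. *)
    define s where "s = sum y S'"
    have s: "s > 0" unfolding s_def using y assms \<open>finite S'\<close> by (intro sum_pos) auto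
    define u where "u i = (if i \<in> S' then y i / s else 0)" for i
    have "sum u S' = sum y S' / s" by (simp add: u_def sum_divide_distrib)
    then have "sum u S' = 1" using s by (simp add: s_def)
    then have "(\<Sum>\<beta>\<in>D. c \<beta> * monomial S \<beta> u) = 0"
      using s y by (intro zero) (auto simp: u_def coordinate_simplex_def less_imp_le)
    also have "(\<Sum>\<beta>\<in>D. c \<beta> * monomial S \<beta> u) = (\<Sum>\<beta>\<in>D \<inter> multi_indices S' k. c \<beta> * monomial S \<beta> u)"
    proof (rule sum.mono_neutral_right[OF finD])
      show "\<forall>i\<in>D - D \<inter> multi_indices S' k. c i * monomial S i u = 0"
      proof
        fix \<gamma> assume g: "\<gamma> \<in> D - D \<inter> multi_indices S' k"
        then obtain i where i: "i \<in> S - S'" "\<gamma> i \<noteq> 0"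
          using multi_indices_face_iff[of S S' \<gamma> k] assms by auto
        then have "monomial S \<gamma> u = 0" using assms by (intro monomial_eq_0[of _ i]) (auto simp: u_def)
        then show "c \<gamma> * monomial S \<gamma> u = 0" by simp
      qed
    qed auto
    also have "\<dots> = (\<Sum>\<beta>\<in>D \<inter> multi_indices S' k. (1 / s) ^ k * (c \<beta> * monomial S' \<beta> y))"
    proof (intro sum.cong refl)
      fix \<gamma> assume g: "\<gamma> \<in> D \<inter> multi_indices S' k"
      have "monomial S \<gamma> u = monomial S' \<gamma> u" using g assms by (intro monomial_face) auto
      also have "\<dots> = monomial S' \<gamma> (\<lambda>i. (1 / s) * y i)"
        unfolding monomial_def by (intro prod.cong) (auto simp: u_def)
      also have "\<dots> = (1 / s) ^ k * monomial S' \<gamma> y" using g by (intro monomial_scale) auto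
      finally show "c \<gamma> * monomial S \<gamma> u = (1 / s) ^ k * (c \<gamma> * monomial S' \<gamma> y)" by simp
    qed
    finally show ?thesis using s by (simp add: sum_distrib_left[symmetric])
  qed
qed

lemma form_on_face:
  assumes "finite U" "S \<subseteq> U" "S' \<subseteq> S" "\<And>j. j \<in> S - S' \<Longrightarrow> y j = 0"
  shows "(\<Sum>\<beta>\<in>multi_indices S k. c \<beta> * monomial U \<beta> y) = (\<Sum>\<beta>\<in>multi_indices S' k. c \<beta> * monomial U \<beta> y)"
proof (rule sum.mono_neutral_right)
  have fin: "finite S" using assms finite_subset by blast
  then show "finite (multi_indices S k)" by (rule finite_multi_indices)
  show "multi_indices S' k \<subseteq> multi_indices S k" using fin assms by (intro multi_indices_mono)
  show "\<forall>\<beta>\<in>multi_indices S k - multi_indices S' k. c \<beta> * monomial U \<beta> y = 0"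
  proof
    fix \<beta> assume "\<beta> \<in> multi_indices S k - multi_indices S' k"
    then obtain j where "j \<in> S - S'" "\<beta> j \<noteq> 0"
      using multi_indices_face_iff[OF fin assms(3)] by auto
    then show "c \<beta> * monomial U \<beta> y = 0"
      using assms monomial_eq_0[of U j y \<beta>] by auto
  qed
qed

section \<open>Polynomials in barycentric coordinates\<close>

lemma finite_degrees: "finite {(i, j, k). int (i + j + k) \<le> r}"
proof (rule finite_subset)
  show "{(i, j, k). int (i + j + k) \<le> r} \<subseteq> {..nat r} \<times> {..nat r} \<times> {..nat r}" by auto
qed auto

lemma poly_fun_iff: "p \<in> poly_fun r \<longleftrightarrow>
    (\<exists>c. \<forall>x. p x = (\<Sum>t\<in>{(i, j, k). int (i + j + k) \<le> r}.
       c t * (x$1 ^ fst t * x$2 ^ fst (snd t) * x$3 ^ snd (snd t))))"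
  by (simp add: poly_fun_def case_prod_beta)

lemma poly_fun_coordinate_monomial:
  assumes "int (i + j + k) \<le> r"
  shows "(\<lambda>x. x$1 ^ i * x$2 ^ j * x$3 ^ k) \<in> poly_fun r"
  unfolding poly_fun_iff
proof (intro exI allI)
  fix x :: "real^3"
  show "x$1 ^ i * x$2 ^ j * x$3 ^ k = (\<Sum>t\<in>{(i, j, k). int (i + j + k) \<le> r}.
      (if t = (i, j, k) then 1 else 0) * (x$1 ^ fst t * x$2 ^ fst (snd t) * x$3 ^ snd (snd t)))"
    using assms finite_degrees[of r]
    by (simp add: if_distrib[of "\<lambda>x. x * _"] cong: if_cong)
qed

lemma poly_fun_0: "(\<lambda>x. 0) \<in> poly_fun r"
  unfolding poly_fun_iff by (rule exI[of _ "\<lambda>_. 0"]) simp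

lemma poly_fun_add: "p \<in> poly_fun r \<Longrightarrow> q \<in> poly_fun r \<Longrightarrow> (\<lambda>x. p x + q x) \<in> poly_fun r"
  unfolding poly_fun_iff
  by (elim exE, rename_tac c d, rule_tac x = "\<lambda>t. c t + d t" in exI)
     (simp add: sum.distrib algebra_simps)

lemma poly_fun_scale: "p \<in> poly_fun r \<Longrightarrow> (\<lambda>x. a * p x) \<in> poly_fun r"
  unfolding poly_fun_iff
  by (elim exE, rename_tac c, rule_tac x = "\<lambda>t. a * c t" in exI)
     (simp add: sum_distrib_left algebra_simps)

lemma poly_fun_sum:
  "(\<And>i. i \<in> I \<Longrightarrow> p i \<in> poly_fun r) \<Longrightarrow> (\<lambda>x. \<Sum>i\<in>I. p i x) \<in> poly_fun r"
  by (induction I rule: infinite_finite_induct) (auto intro: poly_fun_0 poly_fun_add)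

lemma poly_fun_mult:
  assumes "p \<in> poly_fun r" "q \<in> poly_fun s"
  shows "(\<lambda>x. p x * q x) \<in> poly_fun (r + s)"
proof -
  let ?m = "\<lambda>t x. x$1 ^ fst t * x$2 ^ fst (snd t) * x$3 ^ snd (snd t) :: real"
  let ?I = "\<lambda>r. {(i, j, k). int (i + j + k) \<le> r}"
  obtain c where c: "\<And>x. p x = (\<Sum>t\<in>?I r. c t * ?m t x)"
    using assms by (auto simp: poly_fun_iff)
  obtain d where d: "\<And>x. q x = (\<Sum>t\<in>?I s. d t * ?m t x)"
    using assms by (auto simp: poly_fun_iff)
  have "(\<lambda>x. p x * q x) = (\<lambda>x. \<Sum>t\<in>?I r. \<Sum>u\<in>?I s. (c t * d u) *
      (x$1 ^ (fst t + fst u) * x$2 ^ (fst (snd t) + fst (snd u)) * x$3 ^ (snd (snd t) + snd (snd u))))"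
    unfolding c d sum_product
    by (intro ext sum.cong refl) (simp add: power_add algebra_simps)
  also have "\<dots> \<in> poly_fun (r + s)"
    by (intro poly_fun_sum poly_fun_scale poly_fun_coordinate_monomial) auto
  finally show ?thesis .
qed

lemma poly_fun_const: "0 \<le> r \<Longrightarrow> (\<lambda>x. a) \<in> poly_fun r"
  using poly_fun_scale[OF poly_fun_coordinate_monomial[of 0 0 0 r], of a] by simp

lemma poly_fun_linear:
  fixes g :: "real^3 \<Rightarrow> real"
  assumes "linear g"
  shows "(\<lambda>x. a + g (x - v)) \<in> poly_fun 1"
proof -
  have g: "g x = g (axis 1 1) * x$1 + g (axis 2 1) * x$2 + g (axis 3 1) * x$3" for x
  proof -
    have "x = (\<Sum>i\<in>UNIV. x$i *\<^sub>R axis i 1)"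
      using basis_expansion[of x] by (simp add: scalar_mult_eq_scaleR)
    then have "g x = g (\<Sum>i\<in>UNIV. x$i *\<^sub>R axis i 1)" by (rule arg_cong)
    then show ?thesis
      using assms by (simp add: sum_3 linear_add linear_scale algebra_simps)
  qed
  let ?p = "\<lambda>x. (a + g (- v)) + (g (axis 1 1) * (x$1 ^ 1 * x$2 ^ 0 * x$3 ^ 0)
      + (g (axis 2 1) * (x$1 ^ 0 * x$2 ^ 1 * x$3 ^ 0) + g (axis 3 1) * (x$1 ^ 0 * x$2 ^ 0 * x$3 ^ 1)))"
  have "?p \<in> poly_fun 1"
    by (intro poly_fun_add poly_fun_scale poly_fun_coordinate_monomial poly_fun_const) auto
  also have "?p = (\<lambda>x. a + g (x - v))"
  proof (rule ext)
    fix x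
    have "g (x - v) = g x + g (- v)"
      using linear_add[OF assms, of x "- v"] by simp
    then show "?p x = a + g (x - v)" using g[of x] by simp
  qed
  finally show ?thesis .
qed

lemma poly_fun_power: "p \<in> poly_fun r \<Longrightarrow> (\<lambda>x. p x ^ n) \<in> poly_fun (int n * r)"
  by (induction n) (auto intro: poly_fun_const poly_fun_mult simp: algebra_simps)

lemma poly_fun_monomial:
  assumes "finite S" "\<And>j. j \<in> S \<Longrightarrow> L j \<in> poly_fun 1"
  shows "(\<lambda>x. monomial S \<beta> (\<lambda>j. L j x)) \<in> poly_fun (int (sum \<beta> S))"
  using assms unfolding monomial_def
proof (induction S rule: finite_induct)
  case empty
  then show ?case by (simp add: poly_fun_const)
next
  case (insert a S)
  then show ?case
    using poly_fun_mult[OF poly_fun_power[of "L a" 1 "\<beta> a"]] by simp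
qed

lemma continuous_on_poly_fun: "p \<in> poly_fun r \<Longrightarrow> continuous_on A p"
proof -
  assume "p \<in> poly_fun r"
  then obtain c where "p = (\<lambda>x. \<Sum>t\<in>{(i, j, k). int (i + j + k) \<le> r}.
       c t * (x$1 ^ fst t * x$2 ^ fst (snd t) * x$3 ^ snd (snd t)))"
    by (auto simp: poly_fun_iff)
  then show ?thesis by (auto intro!: continuous_intros)
qed

text \<open>
  A coordinate of the point \<open>\<Sum>j\<in>S. y j *\<^sub>R v j\<close> is a linear form in \<open>y\<close>, and \<open>sum y S = 1\<close>
  allows to fill up a product of fewer than \<open>k\<close> coordinates with copies of the linear form \<open>sum y S\<close>.
\<close>

lemma poly_fun_barycentric:
  assumes "finite S" "p \<in> poly_fun (int k)"
  shows "\<exists>c. \<forall>y. sum y S = 1 \<longrightarrow>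
    p (\<Sum>j\<in>S. y j *\<^sub>R v j) = (\<Sum>\<beta>\<in>multi_indices S k. c \<beta> * monomial S \<beta> y)"
proof -
  let ?I = "{(i, j, l). int (i + j + l) \<le> int k}"
  obtain c where c: "\<And>x. p x = (\<Sum>t\<in>?I.
       c t * (x$1 ^ fst t * x$2 ^ fst (snd t) * x$3 ^ snd (snd t)))"
    using assms by (auto simp: poly_fun_iff)
  let ?l = "\<lambda>i y. \<Sum>j\<in>S. y j * (v j $ i)"
  have lin: "form S (n * 1) (\<lambda>y. (?l i y) ^ n)" for i n
    using assms by (intro form_power form_linear)
  have one: "form S (n * 1) (\<lambda>y. (\<Sum>j\<in>S. y j * 1) ^ n)" for n
    using assms by (intro form_power form_linear)
  (* The coordinate monomial t, filled up to degree k. *)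
  let ?f = "\<lambda>t y. (?l 1 y ^ fst t * ?l 2 y ^ fst (snd t) * ?l 3 y ^ snd (snd t))
      * (\<Sum>j\<in>S. y j * 1) ^ (k - (fst t + fst (snd t) + snd (snd t)))"
  have "form S k (?f t)" if "t \<in> ?I" for t
  proof -
    have "form S ((fst t * 1 + fst (snd t) * 1 + snd (snd t) * 1)
        + (k - (fst t + fst (snd t) + snd (snd t))) * 1) (?f t)"
      using assms by (intro form_mult lin one)
    then show ?thesis using that by auto
  qed
  then have "form S k (\<lambda>y. \<Sum>t\<in>?I. c t * ?f t y)"
    by (intro form_sum form_scale)
  then obtain d where d: "\<And>y. (\<Sum>t\<in>?I. c t * ?f t y) = (\<Sum>\<beta>\<in>multi_indices S k. d \<beta> * monomial S \<beta> y)"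
    by (auto simp: form_def)
  show ?thesis
    by (intro exI[of _ d] allI impI) (simp add: c d[symmetric])
qed

text \<open>
  Barycentric coordinates with respect to affinely independent points extend to affine functions on the whole space. The differences \<open>v j - v 0\<close> are independent, so the
  linear part can be prescribed on them.
\<close>

lemma affine_coordinates:
  fixes v :: "nat \<Rightarrow> real^3"
  assumes "inj_on v {..<n}" "\<not> affine_dependent (v ` {..<n})"
  shows "\<exists>L. (\<forall>j. L j \<in> poly_fun 1) \<and>
    (\<forall>y. (\<Sum>j<n. y j) = 1 \<longrightarrow> (\<forall>i<n. L i (\<Sum>j<n. y j *\<^sub>R v j) = y i))"
proof (cases "n = 0")
  case True
  then show ?thesis by (auto intro: poly_fun_0)
next
  case False
  let ?W = "v ` {1..<n}"
  have split: "{..<n} = insert 0 {1..<n}" using False by auto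
  have v0: "v 0 \<notin> ?W" using False inj_on_eq_iff[OF assms(1), of 0] by fastforce
  have ind: "independent ((\<lambda>x. x - v 0) ` ?W)"
    using affine_dependent_iff_dependent[OF v0] assms(2) unfolding split by simp
  have "\<exists>g. linear g \<and> (\<forall>j\<in>{1..<n}. g (v j - v 0) = (if j = i then 1 else 0) - (if i = 0 then 1 else 0 :: real))" for i
  proof -
    (* The values for which the affine function equals 1 at v i and 0 at the other points; for i = 0
       the constant 1 is added below, whence the value -1 at all differences. *)
    let ?f = "\<lambda>x. (if x + v 0 = v i \<and> i < n then 1 else 0) - (if i = 0 then 1 else 0 :: real)"
    obtain g where g: "linear g" "\<forall>x\<in>(\<lambda>x. x - v 0) ` ?W. g x = ?f x"
      using linear_independent_extend[OF ind, of ?f] by auto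
    have "g (v j - v 0) = (if j = i then 1 else 0) - (if i = 0 then 1 else 0)" if "j \<in> {1..<n}" for j
    proof -
      have "g (v j - v 0) = ?f (v j - v 0)" using that by (intro g(2)[rule_format]) auto
      then show ?thesis using that assms(1) by (auto simp: inj_on_def)
    qed
    with g(1) show ?thesis by blast
  qed
  then obtain g where g: "\<And>i. linear (g i)"
    "\<And>i j. j \<in> {1..<n} \<Longrightarrow> g i (v j - v 0) = (if j = i then 1 else 0) - (if i = 0 then 1 else 0 :: real)"
    by metis
  define L where "L i x = (if i = 0 then 1 else 0) + g i (x - v 0)" for i x
  have Lv: "L i (v j) = (if j = i then 1 else 0)" if "j < n" for i j
  proof (cases "j = 0")
    case True
    then show ?thesis using linear_0[OF g(1)] by (auto simp: L_def)
  next
    case False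
    then show ?thesis using g(2)[of j i] that by (auto simp: L_def)
  qed
  have "L i (\<Sum>j<n. y j *\<^sub>R v j) = y i" if y: "(\<Sum>j<n. y j) = 1" "i < n" for y i
  proof -
    have "(\<Sum>j<n. y j *\<^sub>R v j) - v 0 = (\<Sum>j<n. y j *\<^sub>R v j) - (\<Sum>j<n. y j) *\<^sub>R v 0"
      using y by simp
    also have "\<dots> = (\<Sum>j<n. y j *\<^sub>R (v j - v 0))"
      by (simp add: scaleR_sum_left sum_subtractf scaleR_diff_right)
    finally have *: "(\<Sum>j<n. y j *\<^sub>R v j) - v 0 = (\<Sum>j<n. y j *\<^sub>R (v j - v 0))" .
    have "L i (\<Sum>j<n. y j *\<^sub>R v j) = (\<Sum>j<n. y j) * (if i = 0 then 1 else 0) + (\<Sum>j<n. y j * g i (v j - v 0))"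
      unfolding L_def * using y by (simp add: linear_sum[OF g(1)] linear_scale[OF g(1)])
    also have "\<dots> = (\<Sum>j<n. y j * L i (v j))"
      by (simp add: L_def sum_distrib_right sum.distrib algebra_simps)
    also have "\<dots> = (\<Sum>j<n. if j = i then y j else 0)"
      by (intro sum.cong) (auto simp: Lv)
    also have "\<dots> = y i" using y by simp
    finally show ?thesis .
  qed
  moreover have "L j \<in> poly_fun 1" for j
    unfolding L_def[abs_def] by (rule poly_fun_linear[OF g(1)])
  ultimately show ?thesis by blast
qed

text \<open>
  If an exponent \<open>\<beta>\<close> misses the index \<open>j\<close>, then \<open>p\<close> vanishes on the face opposite to \<open>v j\<close>, which
  forces the coefficient of \<open>\<beta>\<close> to vanish. All remaining monomials contain every variable. For
  \<open>k < n\<close> there are none, in accordance with the negative degree of \<open>\<kappa>\<close>.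
\<close>

lemma bubble_factor:
  fixes v :: "nat \<Rightarrow> real^3"
  assumes v: "inj_on v {..<n}" "\<not> affine_dependent (v ` {..<n})" and n: "2 \<le> n"
    and p: "p \<in> poly_fun (int k)"
    and zero: "\<And>y. y \<in> coordinate_simplex {..<n} \<Longrightarrow> \<exists>j<n. y j = 0 \<Longrightarrow> p (\<Sum>j<n. y j *\<^sub>R v j) = 0"
  shows "\<exists>\<kappa>\<in>poly_fun (int k - int n). \<forall>y. (\<Sum>j<n. y j) = 1 \<longrightarrow>
    p (\<Sum>j<n. y j *\<^sub>R v j) = (\<Prod>j<n. y j) * \<kappa> (\<Sum>j<n. y j *\<^sub>R v j)"
proof -
  let ?I = "multi_indices {..<n} k"
  obtain c where c: "\<And>y. (\<Sum>j<n. y j) = 1 \<Longrightarrow>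
      p (\<Sum>j<n. y j *\<^sub>R v j) = (\<Sum>\<beta>\<in>?I. c \<beta> * monomial {..<n} \<beta> y)"
    using poly_fun_barycentric[OF _ p, of "{..<n}" v] by auto
  obtain L where L: "\<And>j. L j \<in> poly_fun 1"
    "\<And>y i. (\<Sum>j<n. y j) = 1 \<Longrightarrow> i < n \<Longrightarrow> L i (\<Sum>j<n. y j *\<^sub>R v j) = y i"
    using affine_coordinates[OF v] by blast
  define D where "D = {\<beta>\<in>?I. \<forall>j<n. \<beta> j \<noteq> 0}"
  have c0: "c \<beta> = 0" if b: "\<beta> \<in> ?I - D" for \<beta>
  proof -
    obtain j where j: "j < n" "\<beta> j = 0" using b by (auto simp: D_def)
    show ?thesis
    proof (rule form_coeffs_eq_0_on_face[where S = "{..<n}" and S' = "{..<n} - {j}" and D = ?I and k = k and c = c and \<beta> = \<beta>])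
      show "{..<n} - {j} \<noteq> {}"
      proof -
        have "(if j = 0 then 1 else 0) \<in> {..<n} - {j}" using n j by auto
        then show ?thesis by blast
      qed
      show "(\<Sum>\<beta>\<in>?I. c \<beta> * monomial {..<n} \<beta> y) = 0" if y: "y \<in> coordinate_simplex ({..<n} - {j})" for y
      proof -
        have y': "y \<in> coordinate_simplex {..<n}"
          using y coordinate_simplex_mono[of "{..<n}" "{..<n} - {j}"] by auto
        moreover have "y j = 0" using y by (auto simp: coordinate_simplex_def)
        ultimately have "p (\<Sum>j<n. y j *\<^sub>R v j) = 0" using j by (intro zero) auto
        then show ?thesis using c[of y] y' by (auto simp: coordinate_simplex_def)
      qed
      show "\<beta> \<in> multi_indices ({..<n} - {j}) k"
        using b j multi_indices_face_iff[of "{..<n}" "{..<n} - {j}" \<beta> k] by auto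
    qed (use b in auto)
  qed
  (* Dividing by the bubble lowers every exponent by 1. *)
  let ?d = "\<lambda>\<beta> i. \<beta> i - (1::nat)"
  let ?k = "\<lambda>x. \<Sum>\<beta>\<in>D. c \<beta> * monomial {..<n} (?d \<beta>) (\<lambda>j. L j x)"
  have "?k \<in> poly_fun (int k - int n)"
  proof (intro poly_fun_sum poly_fun_scale)
    fix \<beta> assume b: "\<beta> \<in> D"
    have "int (sum (?d \<beta>) {..<n}) = (\<Sum>i<n. int (\<beta> i) - 1)"
      unfolding of_nat_sum using b by (intro sum.cong) (auto simp: D_def of_nat_diff)
    also have "\<dots> = int (sum \<beta> {..<n}) - int n" by (simp add: sum_subtractf)
    also have "\<dots> = int k - int n" using b by (auto simp: D_def multi_indices_def)
    finally have s: "int (sum (?d \<beta>) {..<n}) = int k - int n" .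
    show "(\<lambda>x. monomial {..<n} (?d \<beta>) (\<lambda>j. L j x)) \<in> poly_fun (int k - int n)"
      unfolding s[symmetric] by (rule poly_fun_monomial) (auto intro: L)
  qed
  moreover have "p (\<Sum>j<n. y j *\<^sub>R v j) = (\<Prod>j<n. y j) * ?k (\<Sum>j<n. y j *\<^sub>R v j)"
    if y: "(\<Sum>j<n. y j) = 1" for y
  proof -
    have "p (\<Sum>j<n. y j *\<^sub>R v j) = (\<Sum>\<beta>\<in>D. c \<beta> * monomial {..<n} \<beta> y)"
      unfolding c[OF y] using c0
      by (intro sum.mono_neutral_right finite_multi_indices) (auto simp: D_def)
    also have "\<dots> = (\<Sum>\<beta>\<in>D. (\<Prod>j<n. y j) * (c \<beta> * monomial {..<n} (?d \<beta>) y))"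
    proof (intro sum.cong refl)
      fix \<beta> assume b: "\<beta> \<in> D"
      have "monomial {..<n} \<beta> y = (\<Prod>j<n. y j * y j ^ ?d \<beta> j)"
        unfolding monomial_def
      proof (intro prod.cong refl)
        fix j assume "j \<in> {..<n}"
        then have "\<beta> j \<noteq> 0" using b by (auto simp: D_def)
        then show "y j ^ \<beta> j = y j * y j ^ ?d \<beta> j" by (cases "\<beta> j") auto
      qed
      also have "\<dots> = (\<Prod>j<n. y j) * monomial {..<n} (?d \<beta>) y"
        unfolding monomial_def by (rule prod.distrib)
      finally show "c \<beta> * monomial {..<n} \<beta> y = (\<Prod>j<n. y j) * (c \<beta> * monomial {..<n} (?d \<beta>) y)"
        by (simp only: mult.left_commute)
    qed
    also have "\<dots> = (\<Prod>j<n. y j) * ?k (\<Sum>j<n. y j *\<^sub>R v j)"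
      using L(2)[OF y] by (simp add: sum_distrib_left monomial_def)
    finally show ?thesis .
  qed
  ultimately show ?thesis by (intro bexI[of _ ?k] allI impI)
qed

section \<open>Testing with the bubble quotient\<close>

lemma set_integrable_continuous_compact:
  fixes f :: "'a::euclidean_space \<Rightarrow> real"
  assumes "compact S" "continuous_on S f"
  shows "set_integrable lborel S f"
  using borel_integrable_compact[OF assms] by (simp add: set_integrable_def)

text \<open>
  If \<open>f\<close> were positive at a point of \<open>S\<close>, it would be positive on a nonempty open subset of \<open>S\<close>,
  because points of a convex set with interior are limits of interior points; such a set is not
  negligible.
\<close>

lemma integral_eq_0_imp_eq_0:
  fixes f :: "'a::euclidean_space \<Rightarrow> real"
  assumes S: "compact S" "convex S" "interior S \<noteq> {}"
    and f: "continuous_on S f" "\<And>x. x \<in> S \<Longrightarrow> 0 \<le> f x"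
    and int: "(LINT x:S|lborel. f x) = 0" and "x \<in> S"
  shows "f x = 0"
proof (rule ccontr)
  assume "f x \<noteq> 0"
  then have "0 < f x" using f(2) \<open>x \<in> S\<close> by force
  have "integrable lborel (\<lambda>x. indicator S x *\<^sub>R f x)"
    using borel_integrable_compact[OF S(1) f(1)] .
  then have "AE x in lborel. indicator S x *\<^sub>R f x = 0"
    using int f(2) unfolding set_lebesgue_integral_def
    by (subst (asm) integral_nonneg_eq_0_iff_AE) (auto simp: indicator_def)
  then have "AE x in lborel. x \<notin> {x \<in> S. f x \<noteq> 0}"
    by eventually_elim (auto simp: indicator_def split: if_splits)
  then obtain M where M: "M \<in> null_sets lborel" "{x \<in> S. f x \<noteq> 0} \<subseteq> M"
    by (auto simp: eventually_ae_filter)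
  then have neg: "negligible {x \<in> S. f x \<noteq> 0}"
    by (auto simp: negligible_iff_null_sets null_sets_completion_iff2)
  obtain U where U: "open U" "{y\<in>S. 0 < f y} = U \<inter> S"
    using continuous_openin_preimage_gen[OF f(1), of "{0<..}"]
    by (force simp: openin_open vimage_def Int_def)
  have "x \<in> closure (interior S)"
    using convex_closure_interior[OF S(2,3)] \<open>x \<in> S\<close> closure_subset by auto
  then have "U \<inter> interior S \<noteq> {}"
    using U \<open>0 < f x\<close> \<open>x \<in> S\<close> by (subst open_Int_closure_eq_empty[symmetric]) auto
  moreover have "U \<inter> interior S \<subseteq> {x \<in> S. f x \<noteq> 0}"
    using U(2) interior_subset by force
  ultimately show False
    using neg U(1) negligible_subset open_not_negligible by (metis open_Int open_interior)
qed

text \<open>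
  The difference of the two integrals is the integral of the nonnegative function
  \<open>B t * (\<kappa> (\<gamma> t))\<^sup>2 * N\<close>. Here \<open>\<gamma>\<close> parametrizes an edge or a face, \<open>B\<close> is its bubble and \<open>N\<close> the constant
  length or area factor.
\<close>

lemma bubble_moments_determine:
  fixes K :: "'a::euclidean_space set" and \<gamma> :: "'a \<Rightarrow> real^3"
  assumes K: "compact K" "convex K" "interior K \<noteq> {}"
    and \<gamma>: "continuous_on K \<gamma>"
    and poly: "p \<in> poly_fun i" "q \<in> poly_fun j" "\<kappa> \<in> poly_fun l"
    and B: "\<And>t. t \<in> K \<Longrightarrow> 0 \<le> B t" "\<And>t. t \<in> K \<Longrightarrow> p (\<gamma> t) - q (\<gamma> t) = B t * \<kappa> (\<gamma> t)"
    and N: "0 < N"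
    and int: "(LINT t:K|lborel. p (\<gamma> t) * \<kappa> (\<gamma> t) * N) = (LINT t:K|lborel. q (\<gamma> t) * \<kappa> (\<gamma> t) * N)"
    and t: "t \<in> K"
  shows "p (\<gamma> t) = q (\<gamma> t)"
proof -
  have cont: "continuous_on K (\<lambda>t. p (\<gamma> t))" "continuous_on K (\<lambda>t. q (\<gamma> t))" "continuous_on K (\<lambda>t. \<kappa> (\<gamma> t))"
    by (rule continuous_on_compose2[OF continuous_on_poly_fun \<gamma> subset_UNIV], rule poly)+
  let ?f = "\<lambda>t. p (\<gamma> t) * \<kappa> (\<gamma> t) * N - q (\<gamma> t) * \<kappa> (\<gamma> t) * N"
  have f: "?f t = B t * (\<kappa> (\<gamma> t))\<^sup>2 * N" if "t \<in> K" for t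
  proof -
    have "?f t = (p (\<gamma> t) - q (\<gamma> t)) * \<kappa> (\<gamma> t) * N" by (simp add: algebra_simps)
    then show ?thesis unfolding B(2)[OF that] by (simp add: power2_eq_square)
  qed
  have "?f t = 0"
  proof (rule integral_eq_0_imp_eq_0[OF K _ _ _ t])
    show "continuous_on K ?f" by (intro continuous_intros cont)
    show "(LINT t:K|lborel. ?f t) = 0"
      using int
      by (subst set_integral_diff)
         (auto intro!: set_integrable_continuous_compact K continuous_intros cont)
  qed (use f B(1) N in auto)
  then show ?thesis using f[OF t] B(2)[OF t] N by auto
qed

lemma edge_moments_determine:
  fixes \<omega> \<eta> :: "real^3 \<Rightarrow> real"
  assumes "a \<noteq> b" and poly: "p \<in> poly_fun (int k)" "q \<in> poly_fun (int k)"
    and \<omega>: "\<And>x. x \<in> hull_of [a, b] \<Longrightarrow> \<omega> x = p x" "\<And>x. x \<in> hull_of [a, b] \<Longrightarrow> \<eta> x = q x"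
    and vertices: "\<omega> a = \<eta> a" "\<omega> b = \<eta> b"
    and moments: "\<And>\<kappa>. \<kappa> \<in> poly_on (int k - 2) (hull_of [a, b]) \<Longrightarrow>
      edge_integral a b (\<lambda>x. \<omega> x * \<kappa> x) = edge_integral a b (\<lambda>x. \<eta> x * \<kappa> x)"
    and x: "x \<in> hull_of [a, b]"
  shows "\<omega> x = \<eta> x"
proof -
  define v where "v j = [a, b] ! j" for j
  define \<gamma> where "\<gamma> t = a + t *\<^sub>R (b - a)" for t :: real
  have hull: "\<gamma> t \<in> hull_of [a, b]" if "t \<in> {0..1}" for t
    using that by (force simp: hull_of_def segment_convex_hull[symmetric] in_segment \<gamma>_def algebra_simps)
  have v2: "{..<2} = {0, 1::nat}" by auto
  have v: "inj_on v {..<2}" "\<not> affine_dependent (v ` {..<2})"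
    using \<open>a \<noteq> b\<close> by (auto simp: v_def v2)
  have "\<exists>\<kappa>\<in>poly_fun (int k - int 2). \<forall>y. (\<Sum>j<2. y j) = 1 \<longrightarrow>
    p (\<Sum>j<2. y j *\<^sub>R v j) + (- 1) * q (\<Sum>j<2. y j *\<^sub>R v j) = (\<Prod>j<2. y j) * \<kappa> (\<Sum>j<2. y j *\<^sub>R v j)"
  proof (rule bubble_factor[OF v])
    show "(\<lambda>x. p x + (- 1) * q x) \<in> poly_fun (int k)"
      by (intro poly_fun_add poly_fun_scale poly)
    fix y assume "y \<in> coordinate_simplex {..<2}" "\<exists>j<2. y j = 0"
    then have "y 0 = 0 \<and> y 1 = 1 \<or> y 0 = 1 \<and> y 1 = 0"
      by (auto simp: coordinate_simplex_def v2 less_2_cases_iff)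
    moreover have "p a = q a" "p b = q b" using vertices \<omega>[of a] \<omega>[of b] hull[of 0] hull[of 1] by (auto simp: \<gamma>_def)
    ultimately show "p (\<Sum>j<2. y j *\<^sub>R v j) + (- 1) * q (\<Sum>j<2. y j *\<^sub>R v j) = 0"
      by (auto simp: v2 v_def)
  qed auto
  then obtain \<kappa> where \<kappa>: "\<kappa> \<in> poly_fun (int k - 2)"
    "\<And>y. (\<Sum>j<2. y j) = 1 \<Longrightarrow> p (\<Sum>j<2. y j *\<^sub>R v j) + (- 1) * q (\<Sum>j<2. y j *\<^sub>R v j)
       = (\<Prod>j<2. y j) * \<kappa> (\<Sum>j<2. y j *\<^sub>R v j)" by auto
  (* The barycentric coordinates of the point with parameter t are 1 - t and t. *)
  have eq: "p (\<gamma> t) - q (\<gamma> t) = ((1 - t) * t) * \<kappa> (\<gamma> t)" for t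
  proof -
    have "(\<Sum>j<2. [1 - t, t] ! j *\<^sub>R v j) = \<gamma> t" by (simp add: v2 v_def \<gamma>_def algebra_simps)
    then show ?thesis using \<kappa>(2)[of "\<lambda>j. [1 - t, t] ! j"] by (simp add: v2)
  qed
  have "edge_integral a b (\<lambda>x. \<omega> x * on_set (hull_of [a, b]) \<kappa> x)
      = edge_integral a b (\<lambda>x. \<eta> x * on_set (hull_of [a, b]) \<kappa> x)"
    using \<kappa>(1) by (intro moments) (auto simp: poly_on_def)
  moreover have "edge_integral a b (\<lambda>x. \<omega> x * on_set (hull_of [a, b]) \<kappa> x)
      = (LINT t:{0..1}|lborel. p (\<gamma> t) * \<kappa> (\<gamma> t) * norm (b - a))"
    unfolding edge_integral_def \<gamma>_def[symmetric]
    by (intro set_lebesgue_integral_cong) (auto simp: on_set_def \<omega> hull)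
  moreover have "edge_integral a b (\<lambda>x. \<eta> x * on_set (hull_of [a, b]) \<kappa> x)
      = (LINT t:{0..1}|lborel. q (\<gamma> t) * \<kappa> (\<gamma> t) * norm (b - a))"
    unfolding edge_integral_def \<gamma>_def[symmetric]
    by (intro set_lebesgue_integral_cong) (auto simp: on_set_def \<omega> hull)
  ultimately have "(LINT t:{0..1}|lborel. p (\<gamma> t) * \<kappa> (\<gamma> t) * norm (b - a))
      = (LINT t:{0..1}|lborel. q (\<gamma> t) * \<kappa> (\<gamma> t) * norm (b - a))" by simp
  then have pq: "p (\<gamma> t) = q (\<gamma> t)" if "t \<in> {0..1}" for t
    using that \<open>a \<noteq> b\<close>
    by (intro bubble_moments_determine[of "{0..1}" \<gamma> p "int k" q "int k" \<kappa> "int k - 2" "\<lambda>t. (1 - t) * t" "norm (b - a)"] poly \<kappa>(1) eq)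
       (auto simp: \<gamma>_def[abs_def] intro!: continuous_intros)
  obtain t where "t \<in> {0..1}" "x = \<gamma> t"
    using x by (auto simp: hull_of_def segment_convex_hull[symmetric] in_segment \<gamma>_def algebra_simps)
  then show ?thesis using pq[of t] \<omega> x by simp
qed

lemma unit_triangle:
  shows compact_unit_triangle: "compact {(s, t). 0 \<le> s \<and> 0 \<le> t \<and> s + t \<le> (1::real)}"
    and convex_unit_triangle: "convex {(s, t). 0 \<le> s \<and> 0 \<le> t \<and> s + t \<le> (1::real)}"
    and interior_unit_triangle: "interior {(s, t). 0 \<le> s \<and> 0 \<le> t \<and> s + t \<le> (1::real)} \<noteq> {}"
proof -
  let ?K = "{(s, t). 0 \<le> s \<and> 0 \<le> t \<and> s + t \<le> (1::real)}"
  have K: "?K = {p. 0 \<le> fst p} \<inter> {p. 0 \<le> snd p} \<inter> {p. fst p + snd p \<le> 1}" by auto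
  have "closed ?K" unfolding K by (intro closed_Int closed_Collect_le continuous_intros)
  moreover have "bounded ?K"
    by (rule bounded_subset[OF bounded_cbox[of "(0, 0)" "(1, 1)"]]) (auto simp: cbox_Pair_eq)
  ultimately show "compact ?K" by (simp add: compact_eq_bounded_closed)
  show "convex ?K"
  proof (rule convexI)
    fix p q :: "real \<times> real" and u w :: real
    assume *: "p \<in> ?K" "q \<in> ?K" "0 \<le> u" "0 \<le> w" "u + w = 1"
    then have "u * (fst p + snd p) + w * (fst q + snd q) \<le> u * 1 + w * 1"
      by (intro add_mono mult_left_mono) auto
    with * show "u *\<^sub>R p + w *\<^sub>R q \<in> ?K" by (auto simp: algebra_simps case_prod_beta)
  qed
  let ?O = "{p. 0 < fst p} \<inter> {p. 0 < snd p} \<inter> {p :: real \<times> real. fst p + snd p < 1}"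
  have "?O \<subseteq> interior ?K"
    by (rule interior_maximal) (auto intro!: open_Int open_Collect_less continuous_intros)
  moreover have "(1/3, 1/3) \<in> ?O" by auto
  ultimately show "interior ?K \<noteq> {}" by blast
qed

lemma face_moments_determine:
  fixes \<omega> \<eta> :: "real^3 \<Rightarrow> real"
  assumes abc: "distinct [a, b, c]" "\<not> affine_dependent {a, b, c}"
    and poly: "p \<in> poly_fun (int k)" "q \<in> poly_fun (int k)"
    and \<omega>: "\<And>x. x \<in> hull_of [a, b, c] \<Longrightarrow> \<omega> x = p x" "\<And>x. x \<in> hull_of [a, b, c] \<Longrightarrow> \<eta> x = q x"
    and edges: "\<And>x. x \<in> hull_of [a, b] \<union> hull_of [a, c] \<union> hull_of [b, c] \<Longrightarrow> \<omega> x = \<eta> x"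
    and moments: "\<And>\<kappa>. \<kappa> \<in> poly_on (int k - 3) (hull_of [a, b, c]) \<Longrightarrow>
      face_integral a b c (\<lambda>x. \<omega> x * \<kappa> x) = face_integral a b c (\<lambda>x. \<eta> x * \<kappa> x)"
    and x: "x \<in> hull_of [a, b, c]"
  shows "\<omega> x = \<eta> x"
proof -
  define v where "v j = [a, b, c] ! j" for j
  define \<gamma> where "\<gamma> t = a + fst t *\<^sub>R (b - a) + snd t *\<^sub>R (c - a)" for t :: "real \<times> real"
  let ?K = "{(s, t). 0 \<le> s \<and> 0 \<le> t \<and> s + t \<le> (1::real)}"
  have v3: "{..<3} = {0, 1, 2::nat}" by auto
  have sum3: "(\<Sum>j<3. y j *\<^sub>R v j) = y 0 *\<^sub>R a + y 1 *\<^sub>R b + y 2 *\<^sub>R c" for y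
    by (simp add: v3 v_def add.assoc)
  have vim: "v ` {..<3} = {a, b, c}" by (auto simp: v_def v3)
  have v: "inj_on v {..<3}" "\<not> affine_dependent (v ` {..<3})"
    using abc unfolding vim by (auto simp: v_def v3)
  have \<gamma>y: "(\<Sum>j<3. [1 - fst t - snd t, fst t, snd t] ! j *\<^sub>R v j) = \<gamma> t" for t
    by (simp add: sum3 \<gamma>_def algebra_simps)
  have hull_v: "hull_of [a, b, c] = (\<lambda>y. \<Sum>j<3. y j *\<^sub>R v j) ` coordinate_simplex {..<3}"
    using convex_hull_indexed[of "{..<3}" v] by (simp add: vim hull_of_def)
  have hull: "\<gamma> t \<in> hull_of [a, b, c]" if "t \<in> ?K" for t
  proof -
    have "\<gamma> t = (1 - fst t - snd t) *\<^sub>R a + fst t *\<^sub>R b + snd t *\<^sub>R c"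
      by (simp add: \<gamma>_def algebra_simps)
    moreover have "0 \<le> 1 - fst t - snd t" "0 \<le> fst t" "0 \<le> snd t" "(1 - fst t - snd t) + fst t + snd t = 1"
      using that by auto
    ultimately show ?thesis unfolding hull_of_def set_simps convex_hull_3 by blast
  qed
  have zero: "p (\<Sum>j<3. y j *\<^sub>R v j) + (- 1) * q (\<Sum>j<3. y j *\<^sub>R v j) = 0"
    if y: "y \<in> coordinate_simplex {..<3}" "\<exists>j<3. y j = 0" for y
  proof -
    let ?x = "\<Sum>j<3. y j *\<^sub>R v j"
    have y3: "0 \<le> y 0" "0 \<le> y 1" "0 \<le> y 2" "y 0 + y 1 + y 2 = 1"
      using y(1) by (auto simp: coordinate_simplex_def v3)
    have "y 0 = 0 \<or> y 1 = 0 \<or> y 2 = 0" using y(2) by (auto simp: numeral_3_eq_3 less_Suc_eq numeral_2_eq_2)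
    then have "?x \<in> hull_of [a, b] \<union> hull_of [a, c] \<union> hull_of [b, c]"
      using y3 unfolding sum3 hull_of_def by (auto simp: convex_hull_2)
    then have "\<omega> ?x = \<eta> ?x" by (rule edges)
    moreover have "?x \<in> hull_of [a, b, c]" using y(1) by (auto simp: hull_v)
    ultimately show ?thesis using \<omega> by simp
  qed
  have "\<exists>\<kappa>\<in>poly_fun (int k - int 3). \<forall>y. (\<Sum>j<3. y j) = 1 \<longrightarrow>
    p (\<Sum>j<3. y j *\<^sub>R v j) + (- 1) * q (\<Sum>j<3. y j *\<^sub>R v j) = (\<Prod>j<3. y j) * \<kappa> (\<Sum>j<3. y j *\<^sub>R v j)"
  proof (rule bubble_factor[OF v])
    show "(\<lambda>x. p x + (- 1) * q x) \<in> poly_fun (int k)"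
      by (intro poly_fun_add poly_fun_scale poly)
  qed (use zero in auto)
  then obtain \<kappa> where \<kappa>: "\<kappa> \<in> poly_fun (int k - 3)"
    "\<And>y. (\<Sum>j<3. y j) = 1 \<Longrightarrow> p (\<Sum>j<3. y j *\<^sub>R v j) + (- 1) * q (\<Sum>j<3. y j *\<^sub>R v j)
       = (\<Prod>j<3. y j) * \<kappa> (\<Sum>j<3. y j *\<^sub>R v j)" by auto
  have eq: "p (\<gamma> t) - q (\<gamma> t) = ((1 - fst t - snd t) * fst t * snd t) * \<kappa> (\<gamma> t)" for t
    using \<kappa>(2)[of "\<lambda>j. [1 - fst t - snd t, fst t, snd t] ! j"] unfolding \<gamma>y by (simp add: v3 mult.assoc)
  let ?N = "norm (cross3 (b - a) (c - a))"
  have "\<not> collinear {a, b, c}" using abc by (simp add: collinear_3_eq_affine_dependent)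
  then have "\<not> collinear {0, b - a, c - a}"
    using collinear_3[of b a c] by (simp add: insert_commute)
  then have N: "0 < ?N" by (simp add: cross_eq_0)
  have meas: "?K \<in> sets lborel" using compact_unit_triangle by (simp add: borel_compact)
  have "face_integral a b c (\<lambda>x. \<omega> x * on_set (hull_of [a, b, c]) \<kappa> x)
      = face_integral a b c (\<lambda>x. \<eta> x * on_set (hull_of [a, b, c]) \<kappa> x)"
    using \<kappa>(1) by (intro moments) (auto simp: poly_on_def)
  moreover have "face_integral a b c (\<lambda>x. \<omega> x * on_set (hull_of [a, b, c]) \<kappa> x)
      = (LINT t:?K|lborel. p (\<gamma> t) * \<kappa> (\<gamma> t) * ?N)"
    unfolding face_integral_def \<gamma>_def[symmetric]
    by (intro set_lebesgue_integral_cong meas allI impI) (use hull in \<open>simp add: on_set_def \<omega>\<close>)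
  moreover have "face_integral a b c (\<lambda>x. \<eta> x * on_set (hull_of [a, b, c]) \<kappa> x)
      = (LINT t:?K|lborel. q (\<gamma> t) * \<kappa> (\<gamma> t) * ?N)"
    unfolding face_integral_def \<gamma>_def[symmetric]
    by (intro set_lebesgue_integral_cong meas allI impI) (use hull in \<open>simp add: on_set_def \<omega>\<close>)
  ultimately have "(LINT t:?K|lborel. p (\<gamma> t) * \<kappa> (\<gamma> t) * ?N)
      = (LINT t:?K|lborel. q (\<gamma> t) * \<kappa> (\<gamma> t) * ?N)" by simp
  then have pq: "p (\<gamma> t) = q (\<gamma> t)" if "t \<in> ?K" for t
    using that
    by (intro bubble_moments_determine[of ?K \<gamma> p "int k" q "int k" \<kappa> "int k - 3" "\<lambda>t. (1 - fst t - snd t) * fst t * snd t" ?N]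
          compact_unit_triangle convex_unit_triangle interior_unit_triangle poly \<kappa>(1) eq N)
       (auto simp: \<gamma>_def[abs_def] intro!: continuous_intros)
  obtain y where y: "y \<in> coordinate_simplex {..<3}" "x = (\<Sum>j<3. y j *\<^sub>R v j)"
    using x by (auto simp: hull_v)
  then have "x = \<gamma> (y 1, y 2)" "(y 1, y 2) \<in> ?K"
  proof -
    have *: "0 \<le> y 0" "0 \<le> y 1" "0 \<le> y 2" "y 0 = 1 - y 1 - y 2"
      using y(1) by (auto simp: coordinate_simplex_def v3)
    then show "(y 1, y 2) \<in> ?K" by simp
    show "x = \<gamma> (y 1, y 2)" unfolding y(2) sum3 *(4) by (simp add: \<gamma>_def algebra_simps)
  qed
  then show ?thesis using pq[of "(y 1, y 2)"] \<omega> x by simp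
qed

section \<open>Counting multi-indices\<close>

text \<open>
  Listing the values of a multi-index turns the count into that of lists with a prescribed sum.
\<close>

lemma card_multi_indices: "card (multi_indices {..<n} k) = (k + n - 1) choose k"
proof -
  let ?L = "{l :: nat list. length l = n \<and> sum_list l = k}"
  let ?f = "\<lambda>\<beta>. map \<beta> [0..<n]"
  have "bij_betw ?f (multi_indices {..<n} k) ?L"
  proof (rule bij_betw_byWitness[where f' = "\<lambda>l i. if i < n then l ! i else 0"])
    show "\<forall>\<beta>\<in>multi_indices {..<n} k. (\<lambda>i. if i < n then ?f \<beta> ! i else 0) = \<beta>"
      by (auto simp: multi_indices_def fun_eq_iff)
    show "\<forall>l\<in>?L. ?f (\<lambda>i. if i < n then l ! i else 0) = l"
      by (auto intro: nth_equalityI)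
    show "?f ` multi_indices {..<n} k \<subseteq> ?L"
      by (auto simp: multi_indices_def sum_list_sum_nth atLeast0LessThan)
    show "(\<lambda>l i. if i < n then l ! i else 0) ` ?L \<subseteq> multi_indices {..<n} k"
      by (auto simp: multi_indices_def sum_list_sum_nth atLeast0LessThan)
  qed
  then have "card (multi_indices {..<n} k) = card ?L" by (rule bij_betw_same_card)
  then show ?thesis by (simp add: card_length_sum_list)
qed

text \<open>
  Subtract 1 from each exponent in \<open>E\<close>.
\<close>

lemma card_positive_multi_indices:
  assumes "finite S" "E \<subseteq> S"
  shows "card {\<beta> \<in> multi_indices S k. \<forall>j\<in>E. \<beta> j \<noteq> 0} =
    (if card E \<le> k then card (multi_indices S (k - card E)) else 0)"
proof -
  let ?P = "{\<beta> \<in> multi_indices S k. \<forall>j\<in>E. \<beta> j \<noteq> 0}"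
  let ?e = "\<lambda>j. if j \<in> E then 1 else (0::nat)"
  have e: "sum ?e S = card E" using assms by (simp add: sum.If_cases Int_absorb1)
  have le: "card E \<le> k" if "\<beta> \<in> ?P" for \<beta>
  proof -
    have "sum ?e S \<le> sum \<beta> S" using that by (intro sum_mono) auto
    then show ?thesis using that e by (auto simp: multi_indices_def)
  qed
  show ?thesis
  proof (cases "card E \<le> k")
    case True
    have "bij_betw (\<lambda>\<beta> j. \<beta> j - ?e j) ?P (multi_indices S (k - card E))"
    proof (rule bij_betw_byWitness[where f' = "\<lambda>\<beta> j. \<beta> j + ?e j"])
      show "\<forall>\<beta>\<in>?P. (\<lambda>j. \<beta> j - ?e j + ?e j) = \<beta>" by (auto simp: fun_eq_iff)
      show "\<forall>\<beta>\<in>multi_indices S (k - card E). (\<lambda>j. \<beta> j + ?e j - ?e j) = \<beta>" by auto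
      show "(\<lambda>\<beta> j. \<beta> j - ?e j) ` ?P \<subseteq> multi_indices S (k - card E)"
      proof clarify
        fix \<beta> assume \<beta>: "\<beta> \<in> multi_indices S k" "\<forall>j\<in>E. \<beta> j \<noteq> 0"
        then have "sum (\<lambda>j. \<beta> j - ?e j) S = sum \<beta> S - sum ?e S"
          by (intro sum_subtractf_nat) auto
        then show "(\<lambda>j. \<beta> j - ?e j) \<in> multi_indices S (k - card E)"
          using \<beta> e by (auto simp: multi_indices_def)
      qed
      show "(\<lambda>\<beta> j. \<beta> j + ?e j) ` multi_indices S (k - card E) \<subseteq> ?P"
        using True e assms by (auto simp: multi_indices_def sum.distrib)
    qed
    then show ?thesis using True by (simp add: bij_betw_same_card)
  next
    case False
    then have empty: "?P = {}" using le by blast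
    show ?thesis unfolding empty using False by simp
  qed
qed

lemma real_choose_2: "real (n choose 2) = real n * (real n - 1) / 2"
  by (simp add: binomial_gbinomial gbinomial_prod_rev numeral_2_eq_2)

lemma real_choose_4: "real (n choose 4) = real n * (real n - 1) * (real n - 2) * (real n - 3) / 24"
proof -
  have "real (n choose 4) = (\<Prod>i\<in>{0, 1, 2, 3::nat}. real n - real i) / fact 4"
  proof -
    have "{0..<4} = {0, 1, 2, 3::nat}" by auto
    then show ?thesis by (simp add: binomial_gbinomial gbinomial_prod_rev)
  qed
  then show ?thesis by (simp add: fact_numeral)
qed

section \<open>Bases and kernels in spaces of functions\<close>

lemma sum_apply: "(\<Sum>i\<in>A. f i) x = (\<Sum>i\<in>A. f i x)"
  by (induction A rule: infinite_finite_induct) auto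

lemma span_dim_of_basis:
  fixes f :: "'i \<Rightarrow> 'v::real_vector"
  assumes B: "finite B"
    and W: "W = {\<Sum>i\<in>B. c i *\<^sub>R f i | c. True}"
    and ind: "\<And>c i. (\<Sum>i\<in>B. c i *\<^sub>R f i) = 0 \<Longrightarrow> i \<in> B \<Longrightarrow> c i = 0"
  shows "W = span (f ` B)" "dim W = card B"
proof -
  have inj: "inj_on f B"
  proof (rule inj_onI, rule ccontr)
    fix i j assume ij: "i \<in> B" "j \<in> B" "f i = f j" "i \<noteq> j"
    let ?c = "\<lambda>l. (if l = i then 1 else 0) - (if l = j then 1 else 0 :: real)"
    have "(\<Sum>l\<in>B. ?c l *\<^sub>R f l) = 0"
      using B ij by (simp add: scaleR_diff_left sum_subtractf if_distrib[of "\<lambda>x. x *\<^sub>R _"] cong: if_cong)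
    from ind[OF this ij(1)] ij(4) show False by simp
  qed
  show 1: "W = span (f ` B)"
  proof (intro equalityI subsetI)
    fix x assume "x \<in> W"
    then obtain c where x: "x = (\<Sum>i\<in>B. c i *\<^sub>R f i)" unfolding W by blast
    show "x \<in> span (f ` B)"
      unfolding x by (rule span_sum, rule span_scale, rule span_base, erule imageI)
  next
    fix x assume "x \<in> span (f ` B)"
    then obtain u where "x = (\<Sum>v\<in>f ` B. u v *\<^sub>R v)" using B by (auto simp: span_finite)
    then have "x = (\<Sum>i\<in>B. u (f i) *\<^sub>R f i)" using inj by (simp add: sum.reindex)
    then show "x \<in> W" unfolding W by (auto intro!: exI[of _ "\<lambda>i. u (f i)"])
  qed
  have "independent (f ` B)"
  proof
    assume "dependent (f ` B)"
    then obtain u where u: "\<exists>v\<in>f ` B. u v \<noteq> 0" "(\<Sum>v\<in>f ` B. u v *\<^sub>R v) = 0"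
      using B by (auto simp: dependent_finite)
    then have "(\<Sum>i\<in>B. u (f i) *\<^sub>R f i) = 0" using inj by (simp add: sum.reindex)
    from ind[OF this] u(1) show False by auto
  qed
  then show "dim W = card B"
    unfolding 1 using inj by (simp add: dim_eq_card_independent card_image)
qed

text \<open>
  The kernel of a nonzero functional together with one vector outside it spans the space. The
  spanning set \<open>F\<close> guarantees finiteness, since the ambient space of functions has infinite dimension.
\<close>

lemma dim_kernel_functional:
  fixes W :: "'v::real_vector set" and \<phi> :: "'v \<Rightarrow> real"
  assumes W: "subspace W" "W \<subseteq> span F" "finite F"
    and \<phi>: "\<And>u v. u \<in> W \<Longrightarrow> v \<in> W \<Longrightarrow> \<phi> (u + v) = \<phi> u + \<phi> v"
      "\<And>a u. u \<in> W \<Longrightarrow> \<phi> (a *\<^sub>R u) = a * \<phi> u"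
    and e: "e \<in> W" "\<phi> e \<noteq> 0"
  shows "dim W = dim {u \<in> W. \<phi> u = 0} + 1"
proof -
  let ?K = "{u \<in> W. \<phi> u = 0}"
  have "\<phi> 0 = 0" using \<phi>(2)[OF e(1), of 0] by simp
  then have K: "subspace ?K"
    using W(1) \<phi> by (auto simp: subspace_def)
  obtain B where B: "B \<subseteq> ?K" "independent B" "?K \<subseteq> span B" "card B = dim ?K"
    using basis_exists[of ?K] by blast
  have spanB: "span B = ?K" using B span_minimal[OF B(1) K] by auto
  have fin: "finite B" using independent_span_bound[OF W(3) B(2)] B(1) W(2) by auto
  have eB: "e \<notin> span B" using e by (auto simp: spanB)
  then have ind: "independent (insert e B)" using B(2) by (simp add: independent_insert)
  have "W = span (insert e B)"
  proof (intro equalityI subsetI)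
    fix u assume u: "u \<in> W"
    let ?a = "\<phi> u / \<phi> e"
    (* Correct u by a multiple of e so that it lies in the kernel. *)
    have ae: "(- ?a) *\<^sub>R e \<in> W" using W(1) e(1) by (rule subspace_scale)
    have "\<phi> (u + (- ?a) *\<^sub>R e) = 0"
      unfolding \<phi>(1)[OF u ae] \<phi>(2)[OF e(1)] using e(2) by simp
    then have "u + (- ?a) *\<^sub>R e \<in> span B"
      unfolding spanB using subspace_add[OF W(1) u ae] by blast
    then have "u - ?a *\<^sub>R e \<in> span B" by simp
    then show "u \<in> span (insert e B)" by (auto simp: span_insert)
  next
    fix u assume "u \<in> span (insert e B)"
    moreover have "span (insert e B) \<subseteq> W" using e B(1) W(1) by (intro span_minimal) auto
    ultimately show "u \<in> W" by blast
  qed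
  then have "dim W = card (insert e B)" using ind by (simp add: dim_eq_card_independent)
  also have "\<dots> = card B + 1" using fin eB span_base by (subst card_insert_disjoint) auto
  finally show ?thesis using B(4) by simp
qed

lemma on_set_scale: "on_set S (\<lambda>x. a * f x) = a *\<^sub>R on_set S f"
  by (auto simp: on_set_def scaleR_fun_def)

lemma on_set_add: "on_set S (\<lambda>x. f x + g x) = on_set S f + on_set S g"
  by (auto simp: on_set_def fun_eq_iff)

lemma subspace_poly_on: "subspace (poly_on r S)"
  unfolding subspace_def poly_on_def
proof (intro conjI ballI allI)
  show "0 \<in> on_set S ` poly_fun r"
    by (intro image_eqI[OF _ poly_fun_0]) (auto simp: on_set_def fun_eq_iff)
  fix f assume "f \<in> on_set S ` poly_fun r"
  then obtain p where p: "p \<in> poly_fun r" "f = on_set S p" by auto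
  show "a *\<^sub>R f \<in> on_set S ` poly_fun r" for a
    by (intro image_eqI[OF _ poly_fun_scale[OF p(1), of a]]) (simp add: p(2) on_set_scale)
  fix g assume "g \<in> on_set S ` poly_fun r"
  then obtain q where q: "q \<in> poly_fun r" "g = on_set S q" by auto
  show "f + g \<in> on_set S ` poly_fun r"
    by (intro image_eqI[OF _ poly_fun_add[OF p(1) q(1)]]) (simp add: p(2) q(2) on_set_add)
qed

lemma dim_poly_on_negative: "r < 0 \<Longrightarrow> dim (poly_on r S) = 0"
proof -
  assume "r < 0"
  then have e: "{(i, j, k). int (i + j + k) \<le> r} = {}" by auto
  have "p \<in> poly_fun r \<longleftrightarrow> p = (\<lambda>x. 0)" for p
    unfolding poly_fun_iff e by (simp add: fun_eq_iff)
  then have "poly_fun r = {\<lambda>x. 0}" by auto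
  then have "poly_on r S = {\<Sum>i\<in>{}. c i *\<^sub>R (0 :: real^3 \<Rightarrow> real) | c::nat \<Rightarrow> real. True}"
    by (auto simp: poly_on_def on_set_def fun_eq_iff)
  from span_dim_of_basis(2)[OF _ this] show ?thesis by simp
qed

text \<open>
  The monomials of degree \<open>k\<close> in the barycentric coordinates form a basis.
\<close>

lemma dim_poly_on_simplex:
  assumes vs: "distinct vs" "\<not> affine_dependent (set vs)" "vs \<noteq> []"
  shows "dim (poly_on (int k) (hull_of vs)) = card (multi_indices {..<length vs} k)"
proof -
  define n where "n = length vs"
  let ?I = "multi_indices {..<n} k"
  have im: "(!) vs ` {..<n} = set vs" by (auto simp: n_def set_conv_nth)
  have inj: "inj_on ((!) vs) {..<n}" using vs(1) by (auto simp: inj_on_def n_def nth_eq_iff_index_eq)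
  have hull: "hull_of vs = (\<lambda>y. \<Sum>j<n. y j *\<^sub>R vs ! j) ` coordinate_simplex {..<n}"
    using convex_hull_indexed[of "{..<n}" "(!) vs"] by (simp add: im hull_of_def)
  obtain L where L: "\<And>j. L j \<in> poly_fun 1"
    "\<And>y i. (\<Sum>j<n. y j) = 1 \<Longrightarrow> i < n \<Longrightarrow> L i (\<Sum>j<n. y j *\<^sub>R vs ! j) = y i"
    using affine_coordinates[OF inj] vs(2) unfolding im by blast
  define f where "f \<beta> = on_set (hull_of vs) (\<lambda>x. monomial {..<n} \<beta> (\<lambda>j. L j x))" for \<beta>
  have f: "f \<beta> (\<Sum>j<n. y j *\<^sub>R vs ! j) = monomial {..<n} \<beta> y" if "y \<in> coordinate_simplex {..<n}" for \<beta> y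
  proof -
    have "(\<Sum>j<n. y j) = 1" using that by (simp add: coordinate_simplex_def)
    then show ?thesis using that L(2)[of y] by (auto simp: f_def on_set_def hull monomial_def)
  qed
  have comb: "(\<Sum>\<beta>\<in>?I. c \<beta> *\<^sub>R f \<beta>) x = (\<Sum>\<beta>\<in>?I. c \<beta> * f \<beta> x)" for c x
    by (simp add: sum_apply scaleR_fun_def)
  have fin: "finite ?I" by (simp add: finite_multi_indices)
  have "dim (poly_on (int k) (hull_of vs)) = card ?I"
  proof (rule span_dim_of_basis(2)[OF fin, of _ f], intro equalityI subsetI)
    fix g assume "g \<in> poly_on (int k) (hull_of vs)"
    then obtain p where p: "p \<in> poly_fun (int k)" "g = on_set (hull_of vs) p" by (auto simp: poly_on_def)
    obtain c where c: "\<And>y. (\<Sum>j<n. y j) = 1 \<Longrightarrow>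
        p (\<Sum>j<n. y j *\<^sub>R vs ! j) = (\<Sum>\<beta>\<in>?I. c \<beta> * monomial {..<n} \<beta> y)"
      using poly_fun_barycentric[OF _ p(1), of "{..<n}" "(!) vs"] by auto
    have "g = (\<Sum>\<beta>\<in>?I. c \<beta> *\<^sub>R f \<beta>)"
    proof (rule ext)
      fix x show "g x = (\<Sum>\<beta>\<in>?I. c \<beta> *\<^sub>R f \<beta>) x"
      proof (cases "x \<in> hull_of vs")
        case True
        then obtain y where y: "y \<in> coordinate_simplex {..<n}" "x = (\<Sum>j<n. y j *\<^sub>R vs ! j)"
          by (auto simp: hull)
        then show ?thesis
          using True c[of y] unfolding comb p(2) by (simp add: f on_set_def) (simp add: coordinate_simplex_def)
      qed (unfold comb p(2), simp add: f_def on_set_def)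
    qed
    then show "g \<in> {\<Sum>\<beta>\<in>?I. c \<beta> *\<^sub>R f \<beta> | c. True}" by blast
  next
    fix g assume "g \<in> {\<Sum>\<beta>\<in>?I. c \<beta> *\<^sub>R f \<beta> | c. True}"
    moreover have "f \<beta> \<in> poly_on (int k) (hull_of vs)" if "\<beta> \<in> ?I" for \<beta>
    proof -
      have "sum \<beta> {..<n} = k" using that by (simp add: multi_indices_def)
      then have "(\<lambda>x. monomial {..<n} \<beta> (\<lambda>j. L j x)) \<in> poly_fun (int k)"
        using poly_fun_monomial[of "{..<n}" L \<beta>] L(1) by simp
      then show ?thesis by (auto simp: f_def poly_on_def)
    qed
    ultimately show "g \<in> poly_on (int k) (hull_of vs)"
      using subspace_poly_on by (auto intro!: subspace_sum subspace_scale)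
  next
    fix c \<beta> assume 0: "(\<Sum>\<beta>\<in>?I. c \<beta> *\<^sub>R f \<beta>) = 0" and \<beta>: "\<beta> \<in> ?I"
    show "c \<beta> = 0"
    proof (rule form_coeffs_eq_0_on_face[where S = "{..<n}" and S' = "{..<n}" and D = ?I and k = k and c = c and \<beta> = \<beta>])
      show "{..<n} \<noteq> {}" using vs(3) by (auto simp: n_def)
      fix y assume y: "y \<in> coordinate_simplex {..<n}"
      have "(\<Sum>\<beta>\<in>?I. c \<beta> * f \<beta> (\<Sum>j<n. y j *\<^sub>R vs ! j)) = 0"
        unfolding comb[symmetric] 0 by simp
      then show "(\<Sum>\<beta>\<in>?I. c \<beta> * monomial {..<n} \<beta> y) = 0" using f[OF y] by simp
    qed (use \<beta> in auto)
  qed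
  then show ?thesis by (simp add: n_def)
qed

lemma subspace_M3: "subspace (M3 r T)"
  unfolding subspace_def
proof (intro conjI ballI allI)
  have p: "0 \<in> poly_on r S" "f \<in> poly_on r S \<Longrightarrow> g \<in> poly_on r S \<Longrightarrow> f + g \<in> poly_on r S"
    "f \<in> poly_on r S \<Longrightarrow> a *\<^sub>R f \<in> poly_on r S" for f g S a
    using subspace_poly_on[of r S] by (auto simp: subspace_def)
  have "on_set S 0 = 0" for S by (auto simp: on_set_def)
  then show "0 \<in> M3 r T" using p(1) by (auto simp: M3_def zero_fun_def)
  fix f assume f: "f \<in> M3 r T"
  show "a *\<^sub>R f \<in> M3 r T" for a
    using f p(3) unfolding M3_def
    by (auto simp: scaleR_fun_def on_set_scale[unfolded scaleR_fun_def] intro!: continuous_intros)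
  fix g assume g: "g \<in> M3 r T"
  show "f + g \<in> M3 r T"
    using f g p(2) unfolding M3_def
    by (auto simp: plus_fun_def on_set_add[unfolded plus_fun_def] intro!: continuous_intros)
qed

lemma M3_set_integrable:
  "\<omega> \<in> M3 r T \<Longrightarrow> set_integrable lborel (hull_of T) \<omega>"
  by (intro set_integrable_continuous_compact) (auto simp: M3_def hull_of_def finite_imp_compact_convex_hull)

section \<open>Subsimplices\<close>

lemma subsimplicesD:
  assumes "vs \<in> subsimplices s T" "distinct T"
  shows "distinct vs" "set vs \<subseteq> set T" "length vs = s + 1"
proof -
  have *: "vs \<in> set (subseqs T)" "length vs = s + 1" using assms(1) by (auto simp: subsimplices_def)
  then show "distinct vs" using subseqs_distinctD assms(2) by blast
  have "set vs \<in> Pow (set T)" using *(1) subseqs_powset[of T] by blast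
  then show "set vs \<subseteq> set T" by simp
  show "length vs = s + 1" by fact
qed

lemma affine_independent_subsimplex:
  "vs \<in> subsimplices s T \<Longrightarrow> distinct T \<Longrightarrow> \<not> affine_dependent (set T) \<Longrightarrow> \<not> affine_dependent (set vs)"
  using subsimplicesD(2) affine_independent_subset by metis

section \<open>Continuous splines on the Alfeld split\<close>

locale alfeld_tetrahedron =
  fixes T :: "(real^3) list"
  assumes length_T: "length T = 4" and distinct_T: "distinct T"
    and nondegenerate_T: "\<not> affine_dependent (set T)"
begin

text \<open>
  The vertices of the split: index 4 is the barycenter, and the piece \<open>T\<^sub>i\<close> has the vertices with
  index different from \<open>i\<close>.
\<close>

definition vertex :: "nat \<Rightarrow> real^3"
  where "vertex j = (if j < 4 then T ! j else barycenter T)"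

definition point :: "(nat \<Rightarrow> real) \<Rightarrow> real^3"
  where "point y = (\<Sum>j<5. y j *\<^sub>R vertex j)"

text \<open>
  Global coordinates on the split: on \<open>T\<^sub>i\<close> the coordinate with index \<open>i\<close> vanishes and the others are
  the barycentric coordinates of the piece.
\<close>

definition split_coordinates :: "(nat \<Rightarrow> real) set"
  where "split_coordinates = {y \<in> coordinate_simplex {..<5}. \<exists>i<4. y i = 0}"

definition bary :: "nat \<Rightarrow> real^3 \<Rightarrow> real"
  where "bary = (SOME L. (\<forall>j. L j \<in> poly_fun 1) \<and>
    (\<forall>y. (\<Sum>j<4. y j) = 1 \<longrightarrow> (\<forall>i<4. L i (\<Sum>j<4. y j *\<^sub>R T ! j) = y i)))"

definition lowest :: "real^3 \<Rightarrow> real"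
  where "lowest x = min (min (bary 0 x) (bary 1 x)) (min (bary 2 x) (bary 3 x))"

text \<open>
  The continuous piecewise affine functions that are 1 at one vertex of the split and 0 at the
  others. On the tetrahedron they invert the map \<open>point\<close>.
\<close>

definition hat :: "nat \<Rightarrow> real^3 \<Rightarrow> real"
  where "hat j x = (if j < 4 then bary j x - lowest x else 4 * lowest x)"

text \<open>
  Exponents that involve all of the indices 0 to 3 are left out, because the corresponding product of
  hat functions is zero.
\<close>

definition split_indices :: "nat \<Rightarrow> (nat \<Rightarrow> nat) set"
  where "split_indices k = {\<beta> \<in> multi_indices {..<5} k. \<exists>i<4. \<beta> i = 0}"

definition spline :: "(nat \<Rightarrow> nat) \<Rightarrow> real^3 \<Rightarrow> real"
  where "spline \<beta> = on_set (hull_of T) (\<lambda>x. monomial {..<5} \<beta> (\<lambda>j. hat j x))"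

abbreviation piece :: "nat \<Rightarrow> nat set"
  where "piece i \<equiv> {..<5} - {i}"

lemma nth_T_image: "(!) T ` {..<4} = set T"
  by (auto simp: set_conv_nth length_T)

lemma nth_T_inj: "inj_on ((!) T) {..<4}"
  using distinct_T by (auto simp: inj_on_def length_T nth_eq_iff_index_eq)

lemma bary_poly_fun: "bary j \<in> poly_fun 1"
  and bary_combination: "(\<Sum>j<4. y j) = 1 \<Longrightarrow> i < 4 \<Longrightarrow> bary i (\<Sum>j<4. y j *\<^sub>R T ! j) = y i"
proof -
  have "\<exists>L. (\<forall>j. L j \<in> poly_fun 1) \<and>
    (\<forall>y. (\<Sum>j<4. y j) = 1 \<longrightarrow> (\<forall>i<4. L i (\<Sum>j<4. y j *\<^sub>R T ! j) = y i))"
    using nth_T_inj nondegenerate_T by (intro affine_coordinates) (auto simp: nth_T_image)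
  note * = someI_ex[OF this, folded bary_def]
  show "bary j \<in> poly_fun 1" using * by blast
  show "(\<Sum>j<4. y j) = 1 \<Longrightarrow> i < 4 \<Longrightarrow> bary i (\<Sum>j<4. y j *\<^sub>R T ! j) = y i" using * by blast
qed

lemma barycenter_T: "barycenter T = (\<Sum>j<4. (1/4) *\<^sub>R T ! j)"
  by (simp add: barycenter_def sum_list_sum_nth length_T scaleR_sum_right atLeast0LessThan)

lemma sum5: "(\<Sum>j<5. f j) = (\<Sum>j<4. f j) + f (4::nat)" for f :: "nat \<Rightarrow> 'b::comm_monoid_add"
  using sum.lessThan_Suc[of f 4] by simp

lemma less_4_iff: "i < 4 \<longleftrightarrow> i = 0 \<or> i = 1 \<or> i = 2 \<or> i = (3::nat)"
  by auto

lemma point_eq: "point y = (\<Sum>j<4. (y j + y 4 / 4) *\<^sub>R T ! j)"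
  by (simp add: point_def sum5 vertex_def barycenter_T scaleR_sum_right scaleR_add_left sum.distrib)

lemma bary_point:
  assumes "y \<in> coordinate_simplex {..<5}" "i < 4"
  shows "bary i (point y) = y i + y 4 / 4"
  unfolding point_eq using assms
  by (intro bary_combination) (auto simp: coordinate_simplex_def sum5 sum.distrib)

lemma lowest_le: "i < 4 \<Longrightarrow> lowest x \<le> bary i x"
  by (auto simp: lowest_def less_4_iff)

lemma lowest_attained: "\<exists>i<4. lowest x = bary i x"
proof -
  have "lowest x = bary 0 x \<or> lowest x = bary 1 x \<or> lowest x = bary 2 x \<or> lowest x = bary 3 x"
    by (auto simp: lowest_def min_def)
  then show ?thesis by (auto simp: less_4_iff)
qed

lemma lowest_piece:
  assumes "y \<in> coordinate_simplex {..<5}" "i < 4" "y i = 0"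
  shows "lowest (point y) = bary i (point y)"
proof (rule antisym)
  obtain l where l: "l < 4" "lowest (point y) = bary l (point y)" using lowest_attained by blast
  have "0 \<le> y l" using assms by (auto simp: coordinate_simplex_def)
  with l show "bary i (point y) \<le> lowest (point y)" using assms by (simp add: bary_point)
qed (use assms lowest_le in auto)

lemma hat_point:
  assumes "y \<in> split_coordinates" "j < 5"
  shows "hat j (point y) = y j"
proof -
  obtain i where i: "i < 4" "y i = 0" and y: "y \<in> coordinate_simplex {..<5}"
    using assms by (auto simp: split_coordinates_def)
  have "lowest (point y) = y 4 / 4" using lowest_piece[OF y i] bary_point[OF y i(1)] i by simp
  moreover have "j < 4 \<or> j = 4" using assms(2) by auto
  ultimately show ?thesis using bary_point[OF y, of j] by (auto simp: hat_def)
qed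

lemma split_coordinates_iff: "y \<in> split_coordinates \<longleftrightarrow> (\<exists>i<4. y \<in> coordinate_simplex (piece i))"
proof -
  have "y \<in> coordinate_simplex (piece i) \<longleftrightarrow> y \<in> coordinate_simplex {..<5} \<and> y i = 0" if "i < 4" for i
    using coordinate_simplex_subset_iff[of "{..<5}" "piece i" y] that
      coordinate_simplex_mono[of "{..<5}" "piece i"] by fastforce
  then show ?thesis unfolding split_coordinates_def by blast
qed

lemma hull_alfeld:
  assumes "i < 4"
  shows "hull_of (alfeld T i) = point ` coordinate_simplex (piece i)"
proof -
  have "set (alfeld T i) = vertex ` piece i"
  proof -
    have len: "length (alfeld T i) = 4" by (simp add: alfeld_def length_T)
    have "set (alfeld T i) = (!) (alfeld T i) ` {..<4}" using len by (auto simp: set_conv_nth)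
    also have "\<dots> = insert (barycenter T) ((!) T ` ({..<4} - {i}))"
      using assms by (auto simp: alfeld_def length_T nth_list_update image_iff)
    also have "\<dots> = vertex ` insert 4 ({..<4} - {i})"
      by (auto simp: vertex_def image_iff)
    also have "insert 4 ({..<4} - {i}) = piece i" using assms by auto
    finally show ?thesis .
  qed
  moreover have "point y = (\<Sum>j\<in>piece i. y j *\<^sub>R vertex j)" if "y \<in> coordinate_simplex (piece i)" for y
    unfolding point_def using that
    by (intro sum.mono_neutral_right) (auto simp: coordinate_simplex_def)
  ultimately show ?thesis
    by (simp add: hull_of_def convex_hull_indexed)
qed

text \<open>
  A point with barycentric coordinates \<open>b\<close> with respect to \<open>T\<close> lies in the piece where \<open>b i\<close> is
  minimal: take the minimum off each coordinate and give four times the minimum to the barycenter.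
\<close>

lemma hull_T: "hull_of T = point ` split_coordinates"
proof (intro equalityI subsetI)
  have T: "hull_of T = (\<lambda>y. \<Sum>j<4. y j *\<^sub>R T ! j) ` coordinate_simplex {..<4}"
    using convex_hull_indexed[of "{..<4}" "(!) T"] by (simp add: hull_of_def nth_T_image)
  {
    fix x assume "x \<in> hull_of T"
    then obtain b where b: "b \<in> coordinate_simplex {..<4}" "x = (\<Sum>j<4. b j *\<^sub>R T ! j)"
      by (auto simp: T)
    have bx: "bary i x = b i" if "i < 4" for i
      using b that by (auto simp: coordinate_simplex_def intro: bary_combination)
    define y where "y j = (if j < 5 then hat j x else 0)" for j
    obtain i where i: "i < 4" "lowest x = bary i x" using lowest_attained by blast
    have "0 \<le> b i" using b by (auto simp: coordinate_simplex_def)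
    with i bx have low: "0 \<le> lowest x" by simp
    have s: "(\<Sum>j<4. b j) = 1" using b by (auto simp: coordinate_simplex_def)
    have "y \<in> coordinate_simplex {..<5}"
      using low lowest_le[of _ x] s
      by (auto simp: coordinate_simplex_def y_def hat_def sum5 sum_subtractf bx)
    moreover have "y i = 0" using i by (auto simp: y_def hat_def)
    moreover have "point y = x"
      unfolding point_eq b(2) by (intro sum.cong) (auto simp: y_def hat_def bx)
    ultimately show "x \<in> point ` split_coordinates"
      using i by (auto simp: split_coordinates_def)
  next
    fix x assume "x \<in> point ` split_coordinates"
    then obtain y where y: "y \<in> coordinate_simplex {..<5}" "x = point y"
      by (auto simp: split_coordinates_def)
    have "(\<lambda>j. if j < 4 then y j + y 4 / 4 else 0) \<in> coordinate_simplex {..<4}"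
      using y by (auto simp: coordinate_simplex_def sum5 sum.distrib)
    moreover have "x = (\<Sum>j<4. (if j < 4 then y j + y 4 / 4 else 0) *\<^sub>R T ! j)"
      unfolding y(2) point_eq by (intro sum.cong) auto
    ultimately show "x \<in> hull_of T"
      unfolding T by (intro image_eqI[of _ _ "\<lambda>j. if j < 4 then y j + y 4 / 4 else 0"])
  }
qed

lemma hull_T_Union: "hull_of T = (\<Union>i<4. hull_of (alfeld T i))"
proof -
  have *: "split_coordinates = (\<Union>i<4. coordinate_simplex (piece i))"
    by (auto simp: split_coordinates_iff)
  show ?thesis unfolding hull_T * image_UN by (auto simp: hull_alfeld)
qed

lemma compact_hull: "compact (hull_of vs)"
  by (simp add: hull_of_def finite_imp_compact_convex_hull)

lemma convex_hull_of: "convex (hull_of vs)"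
  by (simp add: hull_of_def)

lemma card_T: "card (set T) = 4"
  using distinct_T by (simp add: distinct_card length_T)

lemma interior_hull_T: "interior (hull_of T) \<noteq> {}"
  using interior_convex_hull_eq_empty[of "set T"] card_T nondegenerate_T by (simp add: hull_of_def)

text \<open>
  Interior points are those with positive barycentric coordinates, and the smallest of them at
  \<open>point y\<close> is \<open>y 4 / 4\<close>.
\<close>

lemma frontier_point:
  assumes y: "y \<in> split_coordinates"
  shows "point y \<in> frontier (hull_of T) \<longleftrightarrow> y 4 = 0"
proof -
  have y': "y \<in> coordinate_simplex {..<5}" using y by (auto simp: split_coordinates_def)
  have y4: "0 \<le> y j" for j using y' by (auto simp: coordinate_simplex_def)
  have int: "interior (hull_of T) = {x. \<exists>u. (\<forall>v\<in>set T. 0 < u v) \<and> sum u (set T) = 1 \<and> (\<Sum>v\<in>set T. u v *\<^sub>R v) = x}"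
    using interior_convex_hull_explicit_minimal[OF nondegenerate_T] card_T by (simp add: hull_of_def)
  have bij: "bij_betw ((!) T) {..<4} (set T)"
    using nth_T_inj by (simp add: bij_betw_def nth_T_image)
  have "point y \<in> interior (hull_of T) \<longleftrightarrow> y 4 \<noteq> 0"
  proof
    assume "point y \<in> interior (hull_of T)"
    then obtain u where u: "\<forall>v\<in>set T. 0 < u v" "sum u (set T) = 1" "(\<Sum>v\<in>set T. u v *\<^sub>R v) = point y"
      unfolding int by blast
    have 1: "(\<Sum>j<4. u (T ! j)) = 1" using u(2) sum.reindex_bij_betw[OF bij, of u] by simp
    have 2: "point y = (\<Sum>j<4. u (T ! j) *\<^sub>R T ! j)"
      using u(3) sum.reindex_bij_betw[OF bij, of "\<lambda>v. u v *\<^sub>R v"] by simp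
    obtain i where i: "i < 4" "y i = 0" using y by (auto simp: split_coordinates_def)
    have "bary i (point y) = u (T ! i)" unfolding 2 using 1 i by (intro bary_combination) auto
    also have "\<dots> > 0" using u(1) i length_T by auto
    finally show "y 4 \<noteq> 0" using bary_point[OF y' i(1)] i by auto
  next
    assume "y 4 \<noteq> 0"
    then have pos: "0 < y j + y 4 / 4" for j using y4[of 4] y4[of j] by auto
    define u where "u v = (let j = inv_into {..<4} ((!) T) v in y j + y 4 / 4)" for v
    have uT: "u (T ! j) = y j + y 4 / 4" if "j < 4" for j
      using that inv_into_f_f[OF nth_T_inj, of j] by (simp add: u_def Let_def)
    have "\<forall>v\<in>set T. 0 < u v" using pos by (simp add: u_def Let_def)
    moreover have "sum u (set T) = 1"
      using y' sum.reindex_bij_betw[OF bij, of u]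
      by (simp add: uT coordinate_simplex_def sum5 sum.distrib)
    moreover have "(\<Sum>v\<in>set T. u v *\<^sub>R v) = point y"
      using sum.reindex_bij_betw[OF bij, of "\<lambda>v. u v *\<^sub>R v"] by (simp add: uT point_eq)
    ultimately show "point y \<in> interior (hull_of T)" unfolding int by blast
  qed
  moreover have "point y \<in> hull_of T" using y by (auto simp: hull_T)
  ultimately show ?thesis
    using compact_imp_closed[OF compact_hull, of T] by (simp add: frontier_def)
qed

lemma continuous_on_hat: "continuous_on A (hat j)"
  unfolding hat_def[abs_def] lowest_def[abs_def]
  by (cases "j < 4") (auto intro!: continuous_intros continuous_on_poly_fun[OF bary_poly_fun])

lemma spline_point:
  "y \<in> split_coordinates \<Longrightarrow> spline \<beta> (point y) = monomial {..<5} \<beta> y"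
  by (auto simp: spline_def on_set_def hull_T hat_point monomial_def)

text \<open>
  On the piece \<open>T\<^sub>i\<close> the minimum is attained by \<open>bary i\<close>, so the hat functions agree there with affine
  functions.
\<close>

lemma spline_in_M3:
  assumes "\<beta> \<in> multi_indices {..<5} k"
  shows "spline \<beta> \<in> M3 (int k) T"
  unfolding M3_def mem_Collect_eq
proof (intro conjI allI impI)
  show "spline \<beta> x = 0" if "x \<notin> hull_of T" for x using that by (simp add: spline_def on_set_def)
  have "continuous_on (hull_of T) (\<lambda>x. monomial {..<5} \<beta> (\<lambda>j. hat j x))"
    unfolding monomial_def by (intro continuous_intros continuous_on_hat)
  then show "continuous_on (hull_of T) (spline \<beta>)"
    by (rule continuous_on_eq) (simp add: spline_def on_set_def)
  fix i assume "i < length T"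
  then have i: "i < 4" by (simp add: length_T)
  define g where "g j x = (if j < 4 then bary j x + (- 1) * bary i x else 4 * bary i x)" for j x
  have "g j \<in> poly_fun 1" for j
  proof (cases "j < 4")
    case True
    have "(\<lambda>x. bary j x + (- 1) * bary i x) \<in> poly_fun 1"
      by (intro poly_fun_add poly_fun_scale bary_poly_fun)
    with True show ?thesis by (simp add: g_def[abs_def])
  next
    case False
    then show ?thesis by (auto simp: g_def[abs_def] intro: poly_fun_scale bary_poly_fun)
  qed
  then have "(\<lambda>x. monomial {..<5} \<beta> (\<lambda>j. g j x)) \<in> poly_fun (int (sum \<beta> {..<5}))"
    by (intro poly_fun_monomial) auto
  moreover have "sum \<beta> {..<5} = k" using assms by (simp add: multi_indices_def)
  moreover have "spline \<beta> x = monomial {..<5} \<beta> (\<lambda>j. g j x)" if x: "x \<in> hull_of (alfeld T i)" for x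
  proof -
    obtain y where y: "y \<in> coordinate_simplex (piece i)" "x = point y"
      using x by (auto simp: hull_alfeld[OF i])
    then have y': "y \<in> coordinate_simplex {..<5}" "y i = 0"
      using coordinate_simplex_mono[of "{..<5}" "piece i"] by (auto simp: coordinate_simplex_def)
    have "hat j x = g j x" for j
      using lowest_piece[OF y'(1) i y'(2)] by (simp add: hat_def g_def y(2))
    moreover have "x \<in> hull_of T" using x i by (auto simp: hull_T_Union)
    ultimately show ?thesis by (simp add: spline_def on_set_def)
  qed
  then have "on_set (hull_of (alfeld T i)) (spline \<beta>)
      = on_set (hull_of (alfeld T i)) (\<lambda>x. monomial {..<5} \<beta> (\<lambda>j. g j x))"
    by (auto simp: on_set_def fun_eq_iff)
  ultimately show "on_set (hull_of (alfeld T i)) (spline \<beta>) \<in> poly_on (int k) (hull_of (alfeld T i))"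
    unfolding poly_on_def by auto
qed

lemma M3_piece:
  assumes "\<omega> \<in> M3 r T" "i < 4"
  shows "\<exists>p\<in>poly_fun r. \<forall>x\<in>hull_of (alfeld T i). \<omega> x = p x"
proof -
  obtain p where p: "p \<in> poly_fun r" "on_set (hull_of (alfeld T i)) \<omega> = on_set (hull_of (alfeld T i)) p"
    using assms by (auto simp: M3_def length_T poly_on_def)
  have "\<omega> x = p x" if "x \<in> hull_of (alfeld T i)" for x
    using fun_cong[OF p(2), of x] that by (simp add: on_set_def)
  with p show ?thesis by blast
qed

lemma piece_nonempty: "piece i \<inter> piece j \<noteq> {}"
proof -
  have "\<exists>n<3. n \<noteq> i \<and> n \<noteq> j" by presburger
  then obtain n where "n \<in> piece i \<inter> piece j" by force
  then show ?thesis by blast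
qed

text \<open>
  An exponent with \<open>\<beta> i = 0\<close> is detected on the piece \<open>T\<^sub>i\<close>.
\<close>

lemma spline_coeffs_eq_0:
  assumes D: "D \<subseteq> split_indices k"
    and zero: "\<And>y. y \<in> split_coordinates \<Longrightarrow> (\<Sum>\<beta>\<in>D. c \<beta> * monomial {..<5} \<beta> y) = 0"
    and "\<beta> \<in> D"
  shows "c \<beta> = 0"
proof -
  obtain i where i: "i < 4" "\<beta> i = 0" using D \<open>\<beta> \<in> D\<close> by (auto simp: split_indices_def)
  show ?thesis
  proof (rule form_coeffs_eq_0_on_face[where S = "{..<5}" and S' = "piece i" and D = D and k = k and c = c and \<beta> = \<beta>])
    show "piece i \<noteq> {}" using piece_nonempty by blast
    show "\<beta> \<in> multi_indices (piece i) k"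
      using i D \<open>\<beta> \<in> D\<close> multi_indices_face_iff[of "{..<5}" "piece i" \<beta> k] by (auto simp: split_indices_def)
    show "(\<Sum>\<beta>\<in>D. c \<beta> * monomial {..<5} \<beta> y) = 0" if "y \<in> coordinate_simplex (piece i)" for y
      using that i split_coordinates_iff by (intro zero) auto
  qed (use D \<open>\<beta> \<in> D\<close> in \<open>auto simp: split_indices_def\<close>)
qed

text \<open>
  Each piece provides coefficients for the exponents supported on its vertices. Exponents that belong
  to two pieces are supported on the common face, where both expansions represent \<open>\<omega>\<close>; so they get
  the same coefficient from both, and the expansions combine to a global one.
\<close>

lemma M3_expansion:
  assumes \<omega>: "\<omega> \<in> M3 (int k) T"
  shows "\<exists>c. \<forall>y\<in>split_coordinates. \<omega> (point y) = (\<Sum>\<beta>\<in>split_indices k. c \<beta> * monomial {..<5} \<beta> y)"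
proof -
  have "\<exists>c. \<forall>y\<in>coordinate_simplex (piece i).
      \<omega> (point y) = (\<Sum>\<beta>\<in>multi_indices (piece i) k. c \<beta> * monomial {..<5} \<beta> y)" if i: "i < 4" for i
  proof -
    obtain p where p: "p \<in> poly_fun (int k)" "\<And>x. x \<in> hull_of (alfeld T i) \<Longrightarrow> \<omega> x = p x"
      using M3_piece[OF \<omega> i] by blast
    obtain c where c: "\<And>y. sum y (piece i) = 1 \<Longrightarrow>
        p (\<Sum>j\<in>piece i. y j *\<^sub>R vertex j) = (\<Sum>\<beta>\<in>multi_indices (piece i) k. c \<beta> * monomial (piece i) \<beta> y)"
      using poly_fun_barycentric[OF _ p(1), of "piece i" vertex] by auto
    have "\<omega> (point y) = (\<Sum>\<beta>\<in>multi_indices (piece i) k. c \<beta> * monomial {..<5} \<beta> y)"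
      if y: "y \<in> coordinate_simplex (piece i)" for y
    proof -
      have pt: "point y = (\<Sum>j\<in>piece i. y j *\<^sub>R vertex j)"
        unfolding point_def using y
        by (intro sum.mono_neutral_right) (auto simp: coordinate_simplex_def)
      have "\<omega> (point y) = p (point y)" using y by (intro p(2)) (auto simp: hull_alfeld[OF i])
      also have "\<dots> = (\<Sum>\<beta>\<in>multi_indices (piece i) k. c \<beta> * monomial (piece i) \<beta> y)"
        unfolding pt using y by (intro c) (auto simp: coordinate_simplex_def)
      also have "\<dots> = (\<Sum>\<beta>\<in>multi_indices (piece i) k. c \<beta> * monomial {..<5} \<beta> y)"
        by (intro sum.cong refl) (simp add: monomial_face[of "{..<5}" "piece i"])
      finally show ?thesis .
    qed
    then show ?thesis by blast
  qed
  then obtain c where c: "\<And>i y. i < 4 \<Longrightarrow> y \<in> coordinate_simplex (piece i) \<Longrightarrow>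
      \<omega> (point y) = (\<Sum>\<beta>\<in>multi_indices (piece i) k. c i \<beta> * monomial {..<5} \<beta> y)"
    by metis
  have agree: "c i \<beta> = c j \<beta>"
    if ij: "i < 4" "j < 4" and \<beta>: "\<beta> \<in> multi_indices (piece i \<inter> piece j) k" for i j \<beta>
  proof -
    have "c i \<beta> - c j \<beta> = 0"
    proof (rule form_coeffs_eq_0_on_face[where S = "{..<5}" and S' = "piece i \<inter> piece j"
          and D = "multi_indices (piece i \<inter> piece j) k" and k = k and c = "\<lambda>\<beta>. c i \<beta> - c j \<beta>" and \<beta> = \<beta>])
      show "multi_indices (piece i \<inter> piece j) k \<subseteq> multi_indices {..<5} k"
        by (intro multi_indices_mono) auto
      show "(\<Sum>\<beta>\<in>multi_indices (piece i \<inter> piece j) k. (c i \<beta> - c j \<beta>) * monomial {..<5} \<beta> y) = 0"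
        if y: "y \<in> coordinate_simplex (piece i \<inter> piece j)" for y
      proof -
        have "(\<Sum>\<beta>\<in>multi_indices (piece i \<inter> piece j) k. c i \<beta> * monomial {..<5} \<beta> y) = \<omega> (point y)"
          using y ij coordinate_simplex_mono[of "piece i" "piece i \<inter> piece j"]
          by (subst c[of i]) (auto intro!: form_on_face[symmetric] simp: coordinate_simplex_def)
        moreover have "(\<Sum>\<beta>\<in>multi_indices (piece i \<inter> piece j) k. c j \<beta> * monomial {..<5} \<beta> y) = \<omega> (point y)"
          using y ij coordinate_simplex_mono[of "piece j" "piece i \<inter> piece j"]
          by (subst c[of j]) (auto intro!: form_on_face[symmetric] simp: coordinate_simplex_def)
        ultimately show ?thesis by (simp add: left_diff_distrib sum_subtractf)
      qed
    qed (use \<beta> piece_nonempty in auto)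
    then show ?thesis by simp
  qed
  (* By agreement it does not matter at which of its zeros an exponent is evaluated. *)
  define d where "d \<beta> = c (SOME i. i < 4 \<and> \<beta> i = 0) \<beta>" for \<beta>
  have mem: "\<beta> \<in> multi_indices (piece i) k \<longleftrightarrow> \<beta> i = 0" if "\<beta> \<in> multi_indices {..<5} k" "i < 4" for \<beta> i
    using multi_indices_face_iff[of "{..<5}" "piece i" \<beta> k] that by auto
  have d: "d \<beta> = c i \<beta>" if "\<beta> \<in> multi_indices (piece i) k" "i < 4" for \<beta> i
  proof -
    have \<beta>: "\<beta> \<in> multi_indices {..<5} k" using that multi_indices_mono[of "{..<5}" "piece i"] by blast
    have "i < 4 \<and> \<beta> i = 0" using that mem[OF \<beta>, of i] by auto
    then obtain l where l: "l < 4" "\<beta> l = 0" "d \<beta> = c l \<beta>"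
      unfolding d_def by (metis (mono_tags, lifting) someI_ex)
    have "\<forall>j\<in>piece i - piece i \<inter> piece l. \<beta> j = 0" using l(2) by auto
    then have "\<beta> \<in> multi_indices (piece i \<inter> piece l) k"
      by (subst multi_indices_face_iff[of "piece i" _ \<beta> k]) (use that in auto)
    then show ?thesis using agree[of i l \<beta>] that l by simp
  qed
  have "\<omega> (point y) = (\<Sum>\<beta>\<in>split_indices k. d \<beta> * monomial {..<5} \<beta> y)" if y: "y \<in> split_coordinates" for y
  proof -
    obtain i where i: "i < 4" "y \<in> coordinate_simplex (piece i)" using y split_coordinates_iff by auto
    have "\<omega> (point y) = (\<Sum>\<beta>\<in>multi_indices (piece i) k. c i \<beta> * monomial {..<5} \<beta> y)" using c[OF i] .
    also have "\<dots> = (\<Sum>\<beta>\<in>multi_indices (piece i) k. d \<beta> * monomial {..<5} \<beta> y)"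
      using d i by (intro sum.cong) auto
    also have "\<dots> = (\<Sum>\<beta>\<in>split_indices k. d \<beta> * monomial {..<5} \<beta> y)"
    proof (rule sum.mono_neutral_left)
      show "finite (split_indices k)" by (simp add: split_indices_def finite_multi_indices)
      show "multi_indices (piece i) k \<subseteq> split_indices k"
        using multi_indices_mono[of "{..<5}" "piece i" k] mem i by (auto simp: split_indices_def)
      show "\<forall>\<beta>\<in>split_indices k - multi_indices (piece i) k. d \<beta> * monomial {..<5} \<beta> y = 0"
      proof
        fix \<beta> assume "\<beta> \<in> split_indices k - multi_indices (piece i) k"
        then have "\<beta> i \<noteq> 0" using mem i by (auto simp: split_indices_def)
        moreover have "y i = 0" using i by (auto simp: coordinate_simplex_def)
        ultimately show "d \<beta> * monomial {..<5} \<beta> y = 0" using i monomial_eq_0[of "{..<5}" i y \<beta>] by auto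
      qed
    qed
    finally show ?thesis .
  qed
  then show ?thesis by blast
qed

section \<open>The dimension of the interior test space\<close>

definition bubble_indices :: "nat \<Rightarrow> (nat \<Rightarrow> nat) set"
  where "bubble_indices k = {\<beta> \<in> split_indices k. \<beta> 4 \<noteq> 0}"

definition M3_boundary :: "nat \<Rightarrow> (real^3 \<Rightarrow> real) set"
  where "M3_boundary k = {\<omega> \<in> M3 (int k) T. \<forall>x\<in>frontier (hull_of T). \<omega> x = 0}"

lemma finite_bubble_indices: "finite (bubble_indices k)"
  by (simp add: bubble_indices_def split_indices_def finite_multi_indices)

lemma frontier_subset: "frontier (hull_of T) \<subseteq> hull_of T"
  using compact_imp_closed[OF compact_hull] by (rule frontier_subset_closed)

lemma subspace_M3_boundary: "subspace (M3_boundary k)"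
  using subspace_M3[of "int k" T] by (auto simp: subspace_def M3_boundary_def scaleR_fun_def)

lemma spline_in_M3_boundary:
  assumes "\<beta> \<in> bubble_indices k" shows "spline \<beta> \<in> M3_boundary k"
proof -
  have "spline \<beta> x = 0" if x: "x \<in> frontier (hull_of T)" for x
  proof -
    obtain y where y: "y \<in> split_coordinates" "x = point y"
      using x frontier_subset by (auto simp: hull_T)
    then have "y 4 = 0" using x frontier_point by auto
    then show ?thesis
      using y assms monomial_eq_0[of "{..<5}" 4 y \<beta>] by (auto simp: spline_point bubble_indices_def)
  qed
  moreover have "spline \<beta> \<in> M3 (int k) T"
    using assms by (intro spline_in_M3) (auto simp: bubble_indices_def split_indices_def)
  ultimately show ?thesis by (simp add: M3_boundary_def)
qed

text \<open>
  Exponents with \<open>\<beta> 4 = 0\<close> and \<open>\<beta> i = 0\<close> are supported on a boundary face, where \<open>\<omega>\<close> vanishes.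
\<close>

lemma M3_boundary_expansion:
  assumes \<omega>: "\<omega> \<in> M3_boundary k"
  shows "\<exists>c. \<omega> = (\<Sum>\<beta>\<in>bubble_indices k. c \<beta> *\<^sub>R spline \<beta>)"
proof -
  have \<omega>': "\<omega> \<in> M3 (int k) T" using \<omega> by (simp add: M3_boundary_def)
  obtain c where c: "\<And>y. y \<in> split_coordinates \<Longrightarrow>
      \<omega> (point y) = (\<Sum>\<beta>\<in>split_indices k. c \<beta> * monomial {..<5} \<beta> y)"
    using M3_expansion[OF \<omega>'] by blast
  have c0: "c \<beta> = 0" if \<beta>: "\<beta> \<in> split_indices k - bubble_indices k" for \<beta>
  proof -
    obtain i where i: "i < 4" "\<beta> i = 0" "\<beta> 4 = 0"
      using \<beta> by (auto simp: bubble_indices_def split_indices_def)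
    let ?S = "piece i \<inter> piece 4"
    show ?thesis
    proof (rule form_coeffs_eq_0_on_face[where S = "{..<5}" and S' = ?S and D = "split_indices k"
          and k = k and c = c and \<beta> = \<beta>])
      show "?S \<noteq> {}" by (rule piece_nonempty)
      have \<beta>5: "\<beta> \<in> multi_indices {..<5} k" using \<beta> by (auto simp: split_indices_def)
      show "\<beta> \<in> multi_indices ?S k"
        by (subst multi_indices_face_iff[OF _ _ \<beta>5]) (use i in auto)
      fix y assume y: "y \<in> coordinate_simplex ?S"
      then have y': "y \<in> split_coordinates"
        using i(1) coordinate_simplex_mono[of "piece i" ?S] by (auto simp: split_coordinates_iff)
      have "y 4 = 0" using y by (auto simp: coordinate_simplex_def)
      then have "\<omega> (point y) = 0" using \<omega> frontier_point[OF y'] by (auto simp: M3_boundary_def)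
      then show "(\<Sum>\<beta>\<in>split_indices k. c \<beta> * monomial {..<5} \<beta> y) = 0" using c[OF y'] by simp
    qed (use \<beta> in \<open>auto simp: split_indices_def\<close>)
  qed
  have "\<omega> x = (\<Sum>\<beta>\<in>bubble_indices k. c \<beta> *\<^sub>R spline \<beta>) x" for x
  proof (cases "x \<in> hull_of T")
    case True
    then obtain y where y: "y \<in> split_coordinates" "x = point y" by (auto simp: hull_T)
    have "\<omega> x = (\<Sum>\<beta>\<in>bubble_indices k. c \<beta> * monomial {..<5} \<beta> y)"
      unfolding y(2) c[OF y(1)] using c0
      by (intro sum.mono_neutral_right) (auto simp: bubble_indices_def split_indices_def finite_multi_indices)
    then show ?thesis using y by (simp add: sum_apply scaleR_fun_def spline_point)
  next
    case False
    then show ?thesis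
      using \<omega>' by (simp add: sum_apply scaleR_fun_def spline_def on_set_def M3_def)
  qed
  then show ?thesis by blast
qed

lemma M3_boundary_basis:
  shows "M3_boundary k = span (spline ` bubble_indices k)"
    and "dim (M3_boundary k) = card (bubble_indices k)"
proof -
  have W: "M3_boundary k = {\<Sum>\<beta>\<in>bubble_indices k. c \<beta> *\<^sub>R spline \<beta> | c. True}"
    using M3_boundary_expansion spline_in_M3_boundary subspace_M3_boundary
    by (auto intro!: subspace_sum subspace_scale)
  have ind: "c \<beta> = 0"
    if 0: "(\<Sum>\<beta>\<in>bubble_indices k. c \<beta> *\<^sub>R spline \<beta>) = 0" and \<beta>: "\<beta> \<in> bubble_indices k" for c \<beta>
  proof (rule spline_coeffs_eq_0[where c = c and \<beta> = \<beta>, OF _ _ \<beta>])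
    show "bubble_indices k \<subseteq> split_indices k" by (auto simp: bubble_indices_def)
    fix y assume y: "y \<in> split_coordinates"
    have "(\<Sum>\<beta>\<in>bubble_indices k. c \<beta> *\<^sub>R spline \<beta>) (point y) = 0" unfolding 0 by simp
    then show "(\<Sum>\<beta>\<in>bubble_indices k. c \<beta> * monomial {..<5} \<beta> y) = 0"
      using y by (simp add: sum_apply scaleR_fun_def spline_point)
  qed
  show "M3_boundary k = span (spline ` bubble_indices k)"
    by (rule span_dim_of_basis(1)[OF finite_bubble_indices W]) (use ind in blast)
  show "dim (M3_boundary k) = card (bubble_indices k)"
    by (rule span_dim_of_basis(2)[OF finite_bubble_indices W]) (use ind in blast)
qed

text \<open>
  Among the exponents with \<open>\<beta> 4 > 0\<close>, those left out are positive everywhere.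
\<close>

lemma card_bubble_indices:
  assumes "1 \<le> k"
  shows "real (card (bubble_indices k)) = real ((k + 3) choose 4) - real ((k - 1) choose 4)"
proof -
  let ?I = "multi_indices {..<5} k"
  let ?P = "\<lambda>E. {\<beta> \<in> ?I. \<forall>j\<in>E. \<beta> j \<noteq> 0}"
  have pos: "(\<forall>j\<in>{..<5}. \<beta> j \<noteq> 0) \<longleftrightarrow> \<beta> 4 \<noteq> 0 \<and> \<not> (\<exists>i<4. \<beta> i = 0)" for \<beta> :: "nat \<Rightarrow> nat"
  proof -
    have "{..<5} = insert 4 {..<4::nat}" by auto
    then show ?thesis by auto
  qed
  then have U: "?P {4} = bubble_indices k \<union> ?P {..<5}"
    by (auto simp: bubble_indices_def split_indices_def)
  have disjoint: "bubble_indices k \<inter> ?P {..<5} = {}"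
    unfolding pos by (auto simp: bubble_indices_def split_indices_def)
  have "card (?P {4}) = card (bubble_indices k) + card (?P {..<5})"
    unfolding U
    by (rule card_Un_disjoint[OF _ _ disjoint]) (auto simp: finite_bubble_indices finite_multi_indices)
  moreover have "card (?P {4}) = (k + 3) choose 4"
  proof -
    have "card (?P {4}) = (k - 1 + 5 - 1) choose (k - 1)"
      using assms by (subst card_positive_multi_indices) (simp_all add: card_multi_indices)
    also have "\<dots> = (k + 3) choose 4"
      using assms binomial_symmetric[of 4 "k + 3"] by (simp add: add.commute)
    finally show ?thesis .
  qed
  moreover have "card (?P {..<5}) = (k - 1) choose 4"
  proof (cases "5 \<le> k")
    case True
    have "card (?P {..<5}) = (k - 5 + 5 - 1) choose (k - 5)"
      using True by (subst card_positive_multi_indices) (simp_all add: card_multi_indices)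
    also have "\<dots> = (k - 1) choose 4"
      using True binomial_symmetric[of 4 "k - 1"] by simp
    finally show ?thesis .
  next
    case False
    then show ?thesis by (subst card_positive_multi_indices) auto
  qed
  ultimately show ?thesis by simp
qed

text \<open>
  The integral is not the zero functional on \<open>M3_boundary\<close>: the power of the hat function of the
  barycenter is nonnegative and equals 1 at the barycenter.
\<close>

lemma dim_M3_zero:
  assumes "1 \<le> k"
  shows "dim (M3_boundary k) = dim (M3_zero (int k) T) + 1"
proof -
  let ?\<phi> = "\<lambda>\<omega>. LINT x:hull_of T|lborel. \<omega> x"
  have eq: "M3_zero (int k) T = {\<omega> \<in> M3_boundary k. ?\<phi> \<omega> = 0}"
    by (auto simp: M3_zero_def M3_boundary_def)
  (* The k-th power of the hat function of the barycenter. *)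
  define e where "e i = (if i = 4 then k else 0)" for i :: nat
  have e: "e \<in> bubble_indices k"
    using assms by (auto simp: e_def bubble_indices_def split_indices_def multi_indices_def sum5 intro: exI[of _ 0])
  have nonneg: "0 \<le> spline e x" if "x \<in> hull_of T" for x
  proof -
    obtain y where y: "y \<in> split_coordinates" "x = point y" using \<open>x \<in> hull_of T\<close> by (auto simp: hull_T)
    then show ?thesis
      by (auto simp: spline_point monomial_def split_coordinates_def coordinate_simplex_def intro!: prod_nonneg)
  qed
  have "?\<phi> (spline e) \<noteq> 0"
  proof
    assume 0: "?\<phi> (spline e) = 0"
    define y where "y j = (if j = 4 then 1 else 0 :: real)" for j :: nat
    have y: "y \<in> split_coordinates"
      by (auto simp: y_def split_coordinates_def coordinate_simplex_def sum5 intro: exI[of _ 0])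
    have "continuous_on (hull_of T) (spline e)"
      using spline_in_M3_boundary[OF e] by (simp add: M3_boundary_def M3_def)
    then have "spline e (point y) = 0"
      using y by (intro integral_eq_0_imp_eq_0[OF compact_hull convex_hull_of interior_hull_T _ nonneg 0])
        (auto simp: hull_T)
    moreover have "monomial {..<5} e y = 1"
      unfolding monomial_def by (intro prod.neutral) (auto simp: e_def y_def)
    ultimately show False using y by (simp add: spline_point)
  qed
  then have "dim (M3_boundary k) = dim {\<omega> \<in> M3_boundary k. ?\<phi> \<omega> = 0} + 1"
  proof (intro dim_kernel_functional[where F = "spline ` bubble_indices k" and e = "spline e"])
    show "M3_boundary k \<subseteq> span (spline ` bubble_indices k)" using M3_boundary_basis(1) by simp
    show "finite (spline ` bubble_indices k)" using finite_bubble_indices by simp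
    show "spline e \<in> M3_boundary k" using e by (rule spline_in_M3_boundary)
    show "?\<phi> (u + v) = ?\<phi> u + ?\<phi> v" if "u \<in> M3_boundary k" "v \<in> M3_boundary k" for u v
      using that by (auto simp: M3_boundary_def plus_fun_def intro!: set_integral_add M3_set_integrable)
    show "?\<phi> (a *\<^sub>R u) = a * ?\<phi> u" if "u \<in> M3_boundary k" for a u
      by (simp add: scaleR_fun_def)
  qed (rule subspace_M3_boundary)
  then show ?thesis unfolding eq .
qed

section \<open>Unisolvence\<close>

text \<open>
  The difference is one of the test functions, and its square has integral zero.
\<close>

lemma M3_eqI:
  assumes \<omega>: "\<omega> \<in> M3 (int k) T" "\<eta> \<in> M3 (int k) T"
    and bd: "\<And>x. x \<in> frontier (hull_of T) \<Longrightarrow> \<omega> x = \<eta> x"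
    and mean: "(LINT x:hull_of T|lborel. \<omega> x) = (LINT x:hull_of T|lborel. \<eta> x)"
    and moments: "\<And>\<kappa>. \<kappa> \<in> M3_zero (int k) T \<Longrightarrow>
      (LINT x:hull_of T|lborel. \<omega> x * \<kappa> x) = (LINT x:hull_of T|lborel. \<eta> x * \<kappa> x)"
  shows "\<omega> = \<eta>"
proof -
  define u where "u x = \<omega> x - \<eta> x" for x
  have "u = \<omega> - \<eta>" by (simp add: u_def fun_eq_iff)
  then have u: "u \<in> M3 (int k) T" using \<omega> subspace_M3 by (auto intro: subspace_diff)
  have cont: "continuous_on (hull_of T) \<omega>" "continuous_on (hull_of T) \<eta>" "continuous_on (hull_of T) u"
    using \<omega> u by (auto simp: M3_def)
  have "\<forall>x\<in>frontier (hull_of T). u x = 0" using bd by (simp add: u_def)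
  moreover have "(LINT x:hull_of T|lborel. u x) = 0"
    using mean unfolding u_def
    by (subst set_integral_diff) (auto intro: \<omega> M3_set_integrable)
  ultimately have "u \<in> M3_zero (int k) T" using u by (simp add: M3_zero_def)
  then have "(LINT x:hull_of T|lborel. \<omega> x * u x - \<eta> x * u x) = 0"
    using moments
    by (subst set_integral_diff)
       (auto intro!: set_integrable_continuous_compact compact_hull continuous_intros cont)
  then have int: "(LINT x:hull_of T|lborel. (u x)\<^sup>2) = 0"
    by (simp add: u_def power2_eq_square algebra_simps)
  have "(u x)\<^sup>2 = 0" if "x \<in> hull_of T" for x
    by (rule integral_eq_0_imp_eq_0[OF compact_hull convex_hull_of interior_hull_T _ _ int that])
       (auto intro!: continuous_intros cont)
  then have "\<omega> x = \<eta> x" if "x \<in> hull_of T" for x using that by (simp add: u_def)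
  moreover have "\<omega> x = \<eta> x" if "x \<notin> hull_of T" for x using that \<omega> by (simp add: M3_def)
  ultimately show ?thesis by blast
qed

text \<open>
  A proper subsimplex misses a vertex of \<open>T\<close>, hence lies in one of the four pieces. Edges and faces are
  therefore not cut by the split.
\<close>

lemma M3_polynomial_on_face:
  assumes \<omega>: "\<omega> \<in> M3 r T" and vs: "vs \<in> subsimplices s T" "s \<le> 2"
  shows "\<exists>p\<in>poly_fun r. \<forall>x\<in>hull_of vs. \<omega> x = p x"
proof -
  note D = subsimplicesD[OF vs(1) distinct_T]
  have "card (set vs) < card (set T)" using D vs(2) card_T by (simp add: distinct_card)
  then have "\<not> set T \<subseteq> set vs" using card_mono[of "set vs" "set T"] by auto
  then obtain i where i: "i < 4" "T ! i \<notin> set vs" by (auto simp: nth_T_image[symmetric])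
  have "set vs \<subseteq> set (alfeld T i)"
  proof
    fix v assume v: "v \<in> set vs"
    then obtain j where j: "j < 4" "v = T ! j" using D(2) by (auto simp: nth_T_image[symmetric])
    with v i have "j \<noteq> i" by auto
    with j have "v = alfeld T i ! j" "j < length (alfeld T i)" by (auto simp: alfeld_def length_T)
    then show "v \<in> set (alfeld T i)" by simp
  qed
  then have "hull_of vs \<subseteq> hull_of (alfeld T i)" unfolding hull_of_def by (rule hull_mono)
  then show ?thesis using M3_piece[OF \<omega> i(1)] by blast
qed

lemma frontier_in_face:
  assumes x: "x \<in> frontier (hull_of T)"
  shows "\<exists>i<4. x \<in> convex hull ((!) T ` ({..<4} - {i}))"
proof -
  obtain y where y: "y \<in> split_coordinates" "x = point y"
    using x frontier_subset by (auto simp: hull_T)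
  then have y4: "y 4 = 0" using x frontier_point by auto
  obtain i where i: "i < 4" "y i = 0" and y5: "y \<in> coordinate_simplex {..<5}"
    using y by (auto simp: split_coordinates_def)
  let ?F = "{..<4} - {i}"
  have "\<forall>l\<in>{..<5} - ?F. l = i \<or> l = 4" by auto
  then have "\<forall>l\<in>{..<5} - ?F. y l = 0" using i(2) y4 by metis
  then have "y \<in> coordinate_simplex ?F"
    by (subst coordinate_simplex_subset_iff[OF _ _ y5]) auto
  moreover have "x = (\<Sum>j\<in>?F. y j *\<^sub>R T ! j)"
  proof -
    have "x = (\<Sum>j<4. y j *\<^sub>R T ! j)" unfolding y(2) point_eq y4 by simp
    also have "\<dots> = (\<Sum>j\<in>?F. y j *\<^sub>R T ! j)"
      using i by (intro sum.mono_neutral_right) auto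
    finally show ?thesis .
  qed
  ultimately have "x \<in> convex hull ((!) T ` ?F)" by (auto simp: convex_hull_indexed)
  then show ?thesis using i(1) by blast
qed

end

lemma subsimplices_tetrahedron:
  "subsimplices 0 [a, b, c, d] = {[a], [b], [c], [d]}"
  "subsimplices 1 [a, b, c, d] = {[a, b], [a, c], [a, d], [b, c], [b, d], [c, d]}"
  "subsimplices 2 [a, b, c, d] = {[a, b, c], [a, b, d], [a, c, d], [b, c, d]}"
proof -
  have *: "subsimplices s T = set (filter (\<lambda>vs. length vs = s + 1) (subseqs T))" for s T
    by (simp add: subsimplices_def)
  show "subsimplices 0 [a, b, c, d] = {[a], [b], [c], [d]}"
    "subsimplices 1 [a, b, c, d] = {[a, b], [a, c], [a, d], [b, c], [b, d], [c, d]}"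
    "subsimplices 2 [a, b, c, d] = {[a, b, c], [a, b, d], [a, c, d], [b, c, d]}"
    unfolding * by (simp_all add: Let_def del: set_filter)
qed

theorem lemma4p14:
  fixes x0 x1 x2 x3 :: "real^3" and T :: "(real^3) list" and r :: int
  assumes T: "T = [x0, x1, x2, x3]"
    and nondegenerate: "distinct T" "\<not> affine_dependent (set T)"
    and r: "5 \<le> r"
  shows "(\<forall>\<omega> \<in> M3 (r - 3) T. \<forall>\<eta> \<in> M3 (r - 3) T.
      (\<forall>a. [a] \<in> subsimplices 0 T \<longrightarrow> \<omega> a = \<eta> a) \<and>
      (\<forall>a b. [a, b] \<in> subsimplices 1 T \<longrightarrow> (\<forall>\<kappa> \<in> poly_on (r - 5) (hull_of [a, b]).
        edge_integral a b (\<lambda>x. \<omega> x * \<kappa> x) = edge_integral a b (\<lambda>x. \<eta> x * \<kappa> x))) \<and>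
      (\<forall>a b c. [a, b, c] \<in> subsimplices 2 T \<longrightarrow> (\<forall>\<kappa> \<in> poly_on (r - 6) (hull_of [a, b, c]).
        face_integral a b c (\<lambda>x. \<omega> x * \<kappa> x) = face_integral a b c (\<lambda>x. \<eta> x * \<kappa> x))) \<and>
      (LINT x : hull_of T | lborel. \<omega> x) = (LINT x : hull_of T | lborel. \<eta> x) \<and>
      (\<forall>\<kappa> \<in> M3_zero (r - 3) T.
        (LINT x : hull_of T | lborel. \<omega> x * \<kappa> x) = (LINT x : hull_of T | lborel. \<eta> x * \<kappa> x))
      \<longrightarrow> \<omega> = \<eta>) \<and>
    card (subsimplices 0 T) = 4 \<and>
    int (\<Sum>e \<in> subsimplices 1 T. dim (poly_on (r - 5) (hull_of e))) = 6 * (r - 4) \<and>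
    int (\<Sum>F \<in> subsimplices 2 T. dim (poly_on (r - 6) (hull_of F))) = 2 * (r - 4) * (r - 5) \<and>
    real (dim (M3_zero (r - 3) T)) =
      1 / 3 * (2 * real_of_int r - 7) * (real_of_int r ^ 2 - 7 * real_of_int r + 15) - 1"
proof -
  interpret alfeld_tetrahedron T
    using T nondegenerate by unfold_locales simp_all
  obtain k where k: "r = int k + 3" "2 \<le> k" using r by (intro that[of "nat (r - 3)"]) auto
  have r3: "r - 3 = int k" and r5: "r - 5 = int (k - 2)" and r6: "r - 6 = int k - 3"
    using k by auto
  note subs = subsimplices_tetrahedron[of x0 x1 x2 x3, folded T, unfolded One_nat_def]
  have r5': "r - 5 = int k - 2" using k by simp
  have unisolvent: "\<omega> = \<eta>" if M: "\<omega> \<in> M3 (r - 3) T" "\<eta> \<in> M3 (r - 3) T"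
    and vertices: "\<forall>a. [a] \<in> subsimplices 0 T \<longrightarrow> \<omega> a = \<eta> a"
    and edges: "\<forall>a b. [a, b] \<in> subsimplices 1 T \<longrightarrow> (\<forall>\<kappa> \<in> poly_on (r - 5) (hull_of [a, b]).
        edge_integral a b (\<lambda>x. \<omega> x * \<kappa> x) = edge_integral a b (\<lambda>x. \<eta> x * \<kappa> x))"
    and faces: "\<forall>a b c. [a, b, c] \<in> subsimplices 2 T \<longrightarrow> (\<forall>\<kappa> \<in> poly_on (r - 6) (hull_of [a, b, c]).
        face_integral a b c (\<lambda>x. \<omega> x * \<kappa> x) = face_integral a b c (\<lambda>x. \<eta> x * \<kappa> x))"
    and mean: "(LINT x : hull_of T | lborel. \<omega> x) = (LINT x : hull_of T | lborel. \<eta> x)"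
    and interior: "\<forall>\<kappa> \<in> M3_zero (r - 3) T.
        (LINT x : hull_of T | lborel. \<omega> x * \<kappa> x) = (LINT x : hull_of T | lborel. \<eta> x * \<kappa> x)"
  for \<omega> \<eta>
  proof (rule M3_eqI[OF M[unfolded r3] _ mean interior[unfolded r3, rule_format]])
    have edge: "\<omega> x = \<eta> x" if ab: "[a, b] \<in> subsimplices 1 T" and x: "x \<in> hull_of [a, b]" for a b x
    proof -
      obtain p where p: "p \<in> poly_fun (int k)" "\<And>x. x \<in> hull_of [a, b] \<Longrightarrow> \<omega> x = p x"
        using M3_polynomial_on_face[OF M(1)[unfolded r3] ab] by auto
      obtain q where q: "q \<in> poly_fun (int k)" "\<And>x. x \<in> hull_of [a, b] \<Longrightarrow> \<eta> x = q x"
        using M3_polynomial_on_face[OF M(2)[unfolded r3] ab] by auto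
      have "a \<noteq> b" using subsimplicesD(1)[OF ab distinct_T] by simp
      moreover have "\<omega> a = \<eta> a" "\<omega> b = \<eta> b" using ab vertices by (auto simp: subs)
      ultimately show ?thesis
        using edge_moments_determine[OF _ p(1) q(1) p(2) q(2) _ _ edges[unfolded r5', rule_format, OF ab] x] by blast
    qed
    have face: "\<omega> x = \<eta> x" if abc: "[a, b, c] \<in> subsimplices 2 T" and x: "x \<in> hull_of [a, b, c]" for a b c x
    proof -
      obtain p where p: "p \<in> poly_fun (int k)" "\<And>x. x \<in> hull_of [a, b, c] \<Longrightarrow> \<omega> x = p x"
        using M3_polynomial_on_face[OF M(1)[unfolded r3] abc] by auto
      obtain q where q: "q \<in> poly_fun (int k)" "\<And>x. x \<in> hull_of [a, b, c] \<Longrightarrow> \<eta> x = q x"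
        using M3_polynomial_on_face[OF M(2)[unfolded r3] abc] by auto
      have "distinct [a, b, c]" using subsimplicesD(1)[OF abc distinct_T] .
      moreover have "\<not> affine_dependent {a, b, c}"
        using affine_independent_subsimplex[OF abc nondegenerate] by simp
      moreover have "[a, b] \<in> subsimplices 1 T" "[a, c] \<in> subsimplices 1 T" "[b, c] \<in> subsimplices 1 T"
        using abc by (auto simp: subs)
      then have "\<And>x. x \<in> hull_of [a, b] \<union> hull_of [a, c] \<union> hull_of [b, c] \<Longrightarrow> \<omega> x = \<eta> x"
        using edge by blast
      ultimately show ?thesis
        using face_moments_determine[OF _ _ p(1) q(1) p(2) q(2) _ faces[unfolded r6, rule_format, OF abc] x] by blast
    qed
    fix x assume "x \<in> frontier (hull_of T)"
    then obtain i where i: "i < 4" "x \<in> convex hull ((!) T ` ({..<4} - {i}))"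
      using frontier_in_face by blast
    have 4: "{..<4} = {0, 1, 2, 3::nat}" by auto
    have "x \<in> hull_of [x0, x1, x2] \<union> hull_of [x0, x1, x3] \<union> hull_of [x0, x2, x3] \<union> hull_of [x1, x2, x3]"
      using i by (auto simp: less_4_iff 4 T hull_of_def insert_Diff_if)
    then show "\<omega> x = \<eta> x" using face by (auto simp: subs)
  qed
  have vertex_count: "card (subsimplices 0 T) = 4"
    using nondegenerate(1) unfolding T subsimplices_tetrahedron by simp
  have edge_count: "int (\<Sum>e \<in> subsimplices 1 T. dim (poly_on (r - 5) (hull_of e))) = 6 * (r - 4)"
  proof -
    have "dim (poly_on (r - 5) (hull_of e)) = k - 1" if e: "e \<in> subsimplices 1 T" for e
    proof -
      have e2: "distinct e" "length e = 2" "e \<noteq> []" using subsimplicesD[OF e distinct_T] by auto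
      have "dim (poly_on (r - 5) (hull_of e)) = card (multi_indices {..<2} (k - 2))"
        using dim_poly_on_simplex[OF e2(1) affine_independent_subsimplex[OF e nondegenerate] e2(3), of "k - 2"]
        unfolding r5 e2(2) .
      also have "\<dots> = k - 1"
        using k(2) binomial_symmetric[of 1 "k - 1"] by (simp add: card_multi_indices numeral_2_eq_2)
      finally show ?thesis .
    qed
    moreover have "card (subsimplices 1 T) = 6" using nondegenerate(1) unfolding T subsimplices_tetrahedron by simp
    ultimately show ?thesis using k by simp
  qed
  have face_count: "int (\<Sum>F \<in> subsimplices 2 T. dim (poly_on (r - 6) (hull_of F))) = 2 * (r - 4) * (r - 5)"
  proof -
    have "dim (poly_on (r - 6) (hull_of F)) = (k - 1) choose 2" if F: "F \<in> subsimplices 2 T" for F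
    proof (cases "k = 2")
      case True
      then show ?thesis unfolding r6 by (simp add: dim_poly_on_negative)
    next
      case False
      then have k3: "3 \<le> k" using k(2) by simp
      then have r6': "r - 6 = int (k - 3)" using k by simp
      have F3: "distinct F" "length F = 3" "F \<noteq> []" using subsimplicesD[OF F distinct_T] by auto
      have "dim (poly_on (r - 6) (hull_of F)) = card (multi_indices {..<3} (k - 3))"
        unfolding r6' F3(2)[symmetric]
        using F3(1) affine_independent_subsimplex[OF F nondegenerate] F3(3) by (rule dim_poly_on_simplex)
      also have "\<dots> = (k - 1) choose 2"
      proof -
        have "k - 3 + 3 - 1 = k - 1" "k - 1 - 2 = k - 3" "2 \<le> k - 1" using k3 by auto
        then show ?thesis using binomial_symmetric[of 2 "k - 1"] by (simp only: card_multi_indices)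
      qed
      finally show ?thesis .
    qed
    moreover have "card (subsimplices 2 T) = 4" using nondegenerate(1) unfolding T subsimplices_tetrahedron by simp
    ultimately have "real_of_int (int (\<Sum>F \<in> subsimplices 2 T. dim (poly_on (r - 6) (hull_of F))))
        = 4 * real ((k - 1) choose 2)" by simp
    also have "\<dots> = real_of_int (2 * (r - 4) * (r - 5))"
      using k by (simp add: real_choose_2 of_nat_diff)
    finally show ?thesis by (simp only: of_int_eq_iff)
  qed
  have interior_count: "real (dim (M3_zero (r - 3) T)) =
      1 / 3 * (2 * real_of_int r - 7) * (real_of_int r ^ 2 - 7 * real_of_int r + 15) - 1"
  proof -
    have "real (dim (M3_zero (r - 3) T)) = real ((k + 3) choose 4) - real ((k - 1) choose 4) - 1"
      using dim_M3_zero[of k] M3_boundary_basis(2)[of k] card_bubble_indices[of k] k r3 by simp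
    also have "\<dots> = 1 / 3 * (2 * real_of_int r - 7) * (real_of_int r ^ 2 - 7 * real_of_int r + 15) - 1"
    proof -
      have "real ((k + 3) choose 4) = (real k + 3) * (real k + 2) * (real k + 1) * real k / 24"
        unfolding real_choose_4 by (simp add: add.commute)
      moreover have "real ((k - 1) choose 4) = (real k - 1) * (real k - 2) * (real k - 3) * (real k - 4) / 24"
        unfolding real_choose_4 using k(2) by (simp add: of_nat_diff)
      moreover have "(x + 3) * (x + 2) * (x + 1) * x - (x - 1) * (x - 2) * (x - 3) * (x - 4)
          = 8 * ((2 * (x + 3) - 7) * ((x + 3) ^ 2 - 7 * (x + 3) + 15))" for x :: real
        by algebra
      from this[of "real k"] have "(real k + 3) * (real k + 2) * (real k + 1) * real k / 24
          - (real k - 1) * (real k - 2) * (real k - 3) * (real k - 4) / 24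
          = 1 / 3 * (2 * (real k + 3) - 7) * ((real k + 3) ^ 2 - 7 * (real k + 3) + 15)"
        by linarith
      moreover have "real_of_int r = real k + 3" using k(1) by simp
      ultimately show ?thesis by presburger
    qed
    finally show ?thesis .
  qed
  show ?thesis
    by (intro conjI ballI impI vertex_count edge_count face_count interior_count)
       (elim conjE, rule unisolvent; assumption)
qed

end
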